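(* Let $\Lambda$ be an Artin algebra, let $A$ be an indecomposable non-projective $\Lambda$-module and let $\eta:\ 0\to C\xrightarrow{f}B\xrightarrow{g}A\to0$ be an almost split sequence in $\mathrm{mod}\,\Lambda$. Let $p:P\to A$ be the projective cover of $A$ and $e:C\to I$ the injective envelope of $C$. Let $0\to C\xrightarrow{s}Z\xrightarrow{l}P\to0$ be the pull-back of $\eta$ along $p$, with induced map $h:Z\to B$ (so $hs=f$ and $gh=pl$), and let $0\to I\xrightarrow{u}X\xrightarrow{v}A\to0$ be the push-out of $\eta$ along $e$, with induced map $d:B\to X$ (so $df=ue$ and $vd=g$). Then $$0\to(C\xrightarrow{e}I)\xrightarrow{(s,\,u)}(Z\xrightarrow{dh}X)\xrightarrow{(l,\,v)}(P\xrightarrow{p}A)\to0$$ is the almost split sequence in the morphism category $\mathcal H$ of $\Lambda$ ending at $(P\xrightarrow{p}A)$.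
   Context: $\mathrm{mod}\,\Lambda$ is the category of finitely generated left $\Lambda$-modules. The morphism category $\mathcal H=H(\Lambda)$ has as objects the maps $(A\xrightarrow{f}B)$ in $\mathrm{mod}\,\Lambda$; a morphism from $(A\xrightarrow{f}B)$ to $(C\xrightarrow{g}D)$ is a pair $(h_1,h_2)$ with $h_1:A\to C$, $h_2:B\to D$, $gh_1=h_2f$. It is an abelian category, equivalent to the category of finitely generated modules over $T_2(\Lambda)=\begin{pmatrix}\Lambda&\Lambda\\0&\Lambda\end{pmatrix}$; almost split sequences in $\mathcal H$ are understood via this equivalence. *)

theory Defs
  imports "HOL-Algebra.Algebra"
begin

section \<open>Artin algebras and finitely generated left modules\<close>

definition fin_gen :: "('r, 'z) ring_scheme \<Rightarrow> ('r, 'm, 'y) module_scheme \<Rightarrow> bool" where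
  "fin_gen R M \<longleftrightarrow>
     (\<exists>S. finite S \<and> S \<subseteq> carrier M \<and> (\<forall>H. submodule H R M \<and> S \<subseteq> H \<longrightarrow> H = carrier M))"

definition comm_artinian_ring :: "('k, 'z) ring_scheme \<Rightarrow> bool" where
  "comm_artinian_ring R \<longleftrightarrow> cring R \<and>
     (\<forall>I :: nat \<Rightarrow> 'k set. (\<forall>n. ideal (I n) R) \<and> (\<forall>n. I (Suc n) \<subseteq> I n)
        \<longrightarrow> (\<exists>N. \<forall>n\<ge>N. I n = I N))"

text \<open>The locale \<^locale>\<open>algebra\<close> of the library only covers commutative algebras.\<close>

locale artin_algebra = module R L + ring L
  for R :: "('k, 'z) ring_scheme" (structure) and L :: "('k, 'r, 'y) module_scheme" (structure) +
  assumes base_artinian: "comm_artinian_ring R"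
    and smult_mult_left:
      "\<lbrakk>c \<in> carrier R; x \<in> carrier L; y \<in> carrier L\<rbrakk>
        \<Longrightarrow> (c \<odot>\<^bsub>L\<^esub> x) \<otimes>\<^bsub>L\<^esub> y = c \<odot>\<^bsub>L\<^esub> (x \<otimes>\<^bsub>L\<^esub> y)"
    and smult_mult_right:
      "\<lbrakk>c \<in> carrier R; x \<in> carrier L; y \<in> carrier L\<rbrakk>
        \<Longrightarrow> x \<otimes>\<^bsub>L\<^esub> (c \<odot>\<^bsub>L\<^esub> y) = c \<odot>\<^bsub>L\<^esub> (x \<otimes>\<^bsub>L\<^esub> y)"
    and fin_gen_over_base: "fin_gen R L"

text \<open>The locale \<^locale>\<open>module\<close> of the library requires a commutative ring of scalars; this is
  the same list of axioms over an arbitrary ring. As there, the fields \<^const>\<open>monoid.mult\<close> and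
  \<^const>\<open>monoid.one\<close> of the record \<^term>\<open>M\<close> are irrelevant.\<close>

locale left_module = L?: ring L + M?: abelian_group M
  for L :: "('r, 'z) ring_scheme" (structure) and M :: "('r, 'm, 'y) module_scheme" (structure) +
  assumes lm_smult_closed:
      "\<lbrakk>a \<in> carrier L; x \<in> carrier M\<rbrakk> \<Longrightarrow> a \<odot>\<^bsub>M\<^esub> x \<in> carrier M"
    and lm_smult_l_distr:
      "\<lbrakk>a \<in> carrier L; b \<in> carrier L; x \<in> carrier M\<rbrakk>
        \<Longrightarrow> (a \<oplus>\<^bsub>L\<^esub> b) \<odot>\<^bsub>M\<^esub> x = a \<odot>\<^bsub>M\<^esub> x \<oplus>\<^bsub>M\<^esub> b \<odot>\<^bsub>M\<^esub> x"
    and lm_smult_r_distr: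
      "\<lbrakk>a \<in> carrier L; x \<in> carrier M; y \<in> carrier M\<rbrakk>
        \<Longrightarrow> a \<odot>\<^bsub>M\<^esub> (x \<oplus>\<^bsub>M\<^esub> y) = a \<odot>\<^bsub>M\<^esub> x \<oplus>\<^bsub>M\<^esub> a \<odot>\<^bsub>M\<^esub> y"
    and lm_smult_assoc:
      "\<lbrakk>a \<in> carrier L; b \<in> carrier L; x \<in> carrier M\<rbrakk>
        \<Longrightarrow> (a \<otimes>\<^bsub>L\<^esub> b) \<odot>\<^bsub>M\<^esub> x = a \<odot>\<^bsub>M\<^esub> (b \<odot>\<^bsub>M\<^esub> x)"
    and lm_smult_one:
      "x \<in> carrier M \<Longrightarrow> \<one>\<^bsub>L\<^esub> \<odot>\<^bsub>M\<^esub> x = x"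

definition fg_module :: "('r, 'z) ring_scheme \<Rightarrow> ('r, 'm) module \<Rightarrow> bool" where
  "fg_module L M \<longleftrightarrow> left_module L M \<and> fin_gen L M"

text \<open>Homomorphisms are only relevant on the carrier of their domain; equations between them are
  therefore always stated pointwise on that carrier.\<close>

definition mod_hom ::
  "('r, 'z) ring_scheme \<Rightarrow> ('r, 'm) module \<Rightarrow> ('r, 'n) module \<Rightarrow> ('m \<Rightarrow> 'n) set" where
  "mod_hom L M N =
     {f \<in> hom (add_monoid M) (add_monoid N).
        \<forall>r\<in>carrier L. \<forall>x\<in>carrier M. f (r \<odot>\<^bsub>M\<^esub> x) = r \<odot>\<^bsub>N\<^esub> f x}"

text \<open>Notions such as projectivity quantify over all objects of the category of finitely generated
  modules, whereas a HOL formula can only quantify over modules with carrier in one fixed type. The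
  type of lists of scalars is large enough: each finitely generated module (with carrier in any
  type) is isomorphic to one whose carrier is a set of lists of scalars. This is proved as
  \<open>fg_module_iso_test_module\<close> below.\<close>

type_synonym 'r test_module = "('r, 'r list) module"

lemma mod_homI:
  assumes "\<And>x. x \<in> carrier M \<Longrightarrow> f x \<in> carrier N"
    and "\<And>x y. \<lbrakk>x \<in> carrier M; y \<in> carrier M\<rbrakk> \<Longrightarrow> f (x \<oplus>\<^bsub>M\<^esub> y) = f x \<oplus>\<^bsub>N\<^esub> f y"
    and "\<And>r x. \<lbrakk>r \<in> carrier L; x \<in> carrier M\<rbrakk> \<Longrightarrow> f (r \<odot>\<^bsub>M\<^esub> x) = r \<odot>\<^bsub>N\<^esub> f x"
  shows "f \<in> mod_hom L M N"
  using assms by (auto simp: mod_hom_def hom_def)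

context left_module
begin

lemma lm_smult_l_null: "x \<in> carrier M \<Longrightarrow> \<zero>\<^bsub>L\<^esub> \<odot>\<^bsub>M\<^esub> x = \<zero>\<^bsub>M\<^esub>"
  by (metis L.l_zero L.zero_closed M.add.r_cancel_one' lm_smult_closed lm_smult_l_distr)

lemma lm_smult_r_null: "a \<in> carrier L \<Longrightarrow> a \<odot>\<^bsub>M\<^esub> \<zero>\<^bsub>M\<^esub> = \<zero>\<^bsub>M\<^esub>"
  by (metis M.l_zero M.zero_closed M.add.r_cancel_one' lm_smult_closed lm_smult_r_distr)

lemma lm_minus: "x \<in> carrier M \<Longrightarrow> \<ominus>\<^bsub>M\<^esub> x = (\<ominus>\<^bsub>L\<^esub> \<one>\<^bsub>L\<^esub>) \<odot>\<^bsub>M\<^esub> x"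
  by (metis L.a_inv_closed L.l_neg L.one_closed M.minus_equality lm_smult_closed
      lm_smult_l_distr lm_smult_l_null lm_smult_one)

lemma lm_submoduleI:
  assumes "H \<subseteq> carrier M" "\<zero>\<^bsub>M\<^esub> \<in> H"
    and "\<And>a b. \<lbrakk>a \<in> H; b \<in> H\<rbrakk> \<Longrightarrow> a \<oplus>\<^bsub>M\<^esub> b \<in> H"
    and "\<And>a x. \<lbrakk>a \<in> carrier L; x \<in> H\<rbrakk> \<Longrightarrow> a \<odot>\<^bsub>M\<^esub> x \<in> H"
  shows "submodule H L M"
proof -
  have "\<ominus>\<^bsub>M\<^esub> x \<in> H" if "x \<in> H" for x
    using that assms lm_minus by auto
  then show ?thesis
    using assms by (auto intro!: submodule.intro subgroup.intro simp: submodule_axioms_def a_inv_def)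
qed

primrec lincomb :: "'m list \<Rightarrow> 'r list \<Rightarrow> 'm" where
  "lincomb [] rs = \<zero>\<^bsub>M\<^esub>"
| "lincomb (s # ss) rs = hd rs \<odot>\<^bsub>M\<^esub> s \<oplus>\<^bsub>M\<^esub> lincomb ss (tl rs)"

definition coeff_lists :: "nat \<Rightarrow> 'r list set" where
  "coeff_lists n = {rs. length rs = n \<and> set rs \<subseteq> carrier L}"

lemma coeff_lists_Suc: "rs \<in> coeff_lists (Suc n) \<Longrightarrow> hd rs \<in> carrier L \<and> tl rs \<in> coeff_lists n"
  by (cases rs) (auto simp: coeff_lists_def)

lemma coeff_lists_Cons: "\<lbrakk>r \<in> carrier L; rs \<in> coeff_lists n\<rbrakk> \<Longrightarrow> r # rs \<in> coeff_lists (Suc n)"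
  by (auto simp: coeff_lists_def)

lemma lincomb_closed:
  "\<lbrakk>set ss \<subseteq> carrier M; rs \<in> coeff_lists (length ss)\<rbrakk> \<Longrightarrow> lincomb ss rs \<in> carrier M"
  by (induction ss arbitrary: rs) (auto dest!: coeff_lists_Suc intro: lm_smult_closed)

lemma lincomb_add:
  "\<lbrakk>set ss \<subseteq> carrier M; rs \<in> coeff_lists (length ss); qs \<in> coeff_lists (length ss)\<rbrakk>
    \<Longrightarrow> \<exists>ts\<in>coeff_lists (length ss). lincomb ss rs \<oplus>\<^bsub>M\<^esub> lincomb ss qs = lincomb ss ts"
proof (induction ss arbitrary: rs qs)
  case Nil
  then show ?case by auto
next
  case (Cons s ss)
  have c: "hd rs \<in> carrier L" "tl rs \<in> coeff_lists (length ss)"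
    "hd qs \<in> carrier L" "tl qs \<in> coeff_lists (length ss)"
    using Cons.prems coeff_lists_Suc by auto
  obtain ts where ts: "ts \<in> coeff_lists (length ss)"
    "lincomb ss (tl rs) \<oplus>\<^bsub>M\<^esub> lincomb ss (tl qs) = lincomb ss ts"
    using Cons.IH[OF _ c(2,4)] Cons.prems by auto
  have m: "s \<in> carrier M" "lincomb ss (tl rs) \<in> carrier M" "lincomb ss (tl qs) \<in> carrier M"
    using Cons.prems c lincomb_closed by auto
  have "lincomb (s # ss) rs \<oplus>\<^bsub>M\<^esub> lincomb (s # ss) qs
     = lincomb (s # ss) ((hd rs \<oplus>\<^bsub>L\<^esub> hd qs) # ts)"
    using m c ts(2)[symmetric] by (simp add: lm_smult_l_distr lm_smult_closed M.a_ac)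
  then show ?case
    using coeff_lists_Cons[OF _ ts(1)] c by (metis L.a_closed length_Cons)
qed

lemma lincomb_smult:
  "\<lbrakk>set ss \<subseteq> carrier M; rs \<in> coeff_lists (length ss); a \<in> carrier L\<rbrakk>
    \<Longrightarrow> \<exists>ts\<in>coeff_lists (length ss). a \<odot>\<^bsub>M\<^esub> lincomb ss rs = lincomb ss ts"
proof (induction ss arbitrary: rs)
  case Nil
  then show ?case by (auto simp: lm_smult_r_null)
next
  case (Cons s ss)
  have c: "hd rs \<in> carrier L" "tl rs \<in> coeff_lists (length ss)"
    using Cons.prems coeff_lists_Suc by auto
  obtain ts where ts: "ts \<in> coeff_lists (length ss)"
    "a \<odot>\<^bsub>M\<^esub> lincomb ss (tl rs) = lincomb ss ts"
    using Cons.IH[OF _ c(2)] Cons.prems by auto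
  have m: "s \<in> carrier M" "lincomb ss (tl rs) \<in> carrier M"
    using Cons.prems c lincomb_closed by auto
  have "a \<odot>\<^bsub>M\<^esub> lincomb (s # ss) rs = lincomb (s # ss) ((a \<otimes>\<^bsub>L\<^esub> hd rs) # ts)"
    using m c ts(2)[symmetric] Cons.prems
    by (simp add: lm_smult_r_distr lm_smult_closed lm_smult_assoc)
  then show ?case
    using coeff_lists_Cons[OF _ ts(1)] c Cons.prems by (metis L.m_closed length_Cons)
qed

lemma lincomb_zero:
  "set ss \<subseteq> carrier M \<Longrightarrow> lincomb ss (replicate (length ss) \<zero>\<^bsub>L\<^esub>) = \<zero>\<^bsub>M\<^esub>"
  by (induction ss) (auto simp: lm_smult_l_null)

lemma lincomb_generator:
  "\<lbrakk>set ss \<subseteq> carrier M; s \<in> set ss\<rbrakk> \<Longrightarrow> \<exists>ts\<in>coeff_lists (length ss). s = lincomb ss ts"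
proof (induction ss)
  case Nil
  then show ?case by auto
next
  case (Cons t ss)
  have z: "replicate (length ss) \<zero>\<^bsub>L\<^esub> \<in> coeff_lists (length ss)"
    by (auto simp: coeff_lists_def)
  show ?case
  proof (cases "s = t")
    case True
    have "s = lincomb (t # ss) (\<one>\<^bsub>L\<^esub> # replicate (length ss) \<zero>\<^bsub>L\<^esub>)"
      using Cons.prems True by (simp add: lincomb_zero lm_smult_one)
    then show ?thesis
      using coeff_lists_Cons[OF L.one_closed z]
      by (intro bexI[of _ "\<one>\<^bsub>L\<^esub> # replicate (length ss) \<zero>\<^bsub>L\<^esub>"]) simp_all
  next
    case False
    then obtain ts where ts: "ts \<in> coeff_lists (length ss)" "s = lincomb ss ts"
      using Cons by auto
    then have "s = lincomb (t # ss) (\<zero>\<^bsub>L\<^esub> # ts)"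
      using Cons.prems by (simp add: lm_smult_l_null lincomb_closed)
    then show ?thesis
      using coeff_lists_Cons[OF L.zero_closed ts(1)]
      by (intro bexI[of _ "\<zero>\<^bsub>L\<^esub> # ts"]) simp_all
  qed
qed

lemma fin_gen_list_inj:
  assumes "fin_gen L M"
  shows "\<exists>\<phi> :: 'm \<Rightarrow> 'r list. inj_on \<phi> (carrier M)"
proof -
  obtain S where S: "finite S" "S \<subseteq> carrier M"
    "\<And>H. \<lbrakk>submodule H L M; S \<subseteq> H\<rbrakk> \<Longrightarrow> H = carrier M"
    using assms unfolding fin_gen_def by blast
  obtain ss where ss: "set ss = S"
    using finite_list S(1) by blast
  have "submodule (lincomb ss ` coeff_lists (length ss)) L M"
  proof (rule lm_submoduleI)
    have "replicate (length ss) \<zero>\<^bsub>L\<^esub> \<in> coeff_lists (length ss)"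
      by (auto simp: coeff_lists_def)
    then show "\<zero>\<^bsub>M\<^esub> \<in> lincomb ss ` coeff_lists (length ss)"
      using lincomb_zero S ss by (metis image_eqI)
  qed (use lincomb_closed lincomb_add lincomb_smult S ss in \<open>auto simp: image_iff\<close>)
  moreover have "S \<subseteq> lincomb ss ` coeff_lists (length ss)"
    using lincomb_generator S ss by auto
  ultimately have "lincomb ss ` coeff_lists (length ss) = carrier M"
    using S(3) by blast
  then show ?thesis
    by (metis inj_on_inv_into subset_refl)
qed

end

lemma fg_module_transport:
  assumes M: "fg_module L M" and f: "f \<in> mod_hom L M N" and surj: "f ` carrier M = carrier N"
    and N: "left_module L N"
  shows "fg_module L N"
proof -
  interpret M: left_module L M using M by (simp add: fg_module_def)
  interpret N: left_module L N by (rule N)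
  have hom: "f x \<in> carrier N" "f (x \<oplus>\<^bsub>M\<^esub> y) = f x \<oplus>\<^bsub>N\<^esub> f y"
    "r \<in> carrier L \<Longrightarrow> f (r \<odot>\<^bsub>M\<^esub> x) = r \<odot>\<^bsub>N\<^esub> f x"
    if "x \<in> carrier M" "y \<in> carrier M" for x y r
    using f that by (auto simp: mod_hom_def hom_def)
  have f0: "f \<zero>\<^bsub>M\<^esub> = \<zero>\<^bsub>N\<^esub>"
    using hom(3)[of "\<zero>\<^bsub>M\<^esub>" "\<zero>\<^bsub>M\<^esub>" "\<zero>\<^bsub>L\<^esub>"] hom(1)[of "\<zero>\<^bsub>M\<^esub>" "\<zero>\<^bsub>M\<^esub>"]
    by (simp add: M.lm_smult_l_null N.lm_smult_l_null)
  obtain S where S: "finite S" "S \<subseteq> carrier M"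
    "\<And>H. \<lbrakk>submodule H L M; S \<subseteq> H\<rbrakk> \<Longrightarrow> H = carrier M"
    using M unfolding fg_module_def fin_gen_def by blast
  have "H = carrier N" if H: "submodule H L N" "f ` S \<subseteq> H" for H
  proof -
    interpret H: submodule H L N by (rule H)
    have "submodule {x \<in> carrier M. f x \<in> H} L M"
      by (rule M.lm_submoduleI)
        (use hom f0 H.one_closed H.m_closed H.smult_closed M.lm_smult_closed in auto)
    moreover have "S \<subseteq> {x \<in> carrier M. f x \<in> H}"
      using S(2) H(2) by auto
    ultimately have "{x \<in> carrier M. f x \<in> H} = carrier M"
      by (rule S(3))
    then have "f x \<in> H" if "x \<in> carrier M" for x using that by (metis (mono_tags) mem_Collect_eq)
    then have "f ` carrier M \<subseteq> H" by (rule image_subsetI)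
    then have "carrier N \<subseteq> H" by (simp only: surj)
    then show ?thesis using H.subset by auto
  qed
  moreover have "finite (f ` S)" "f ` S \<subseteq> carrier N"
    using S hom by auto
  ultimately show ?thesis
    using N unfolding fg_module_def fin_gen_def by blast
qed

theorem fg_module_iso_test_module:
  fixes L :: "('r, 'z) ring_scheme" and M :: "('r, 'm) module"
  assumes M: "fg_module L M"
  shows "\<exists>(T :: 'r test_module) \<phi>.
    fg_module L T \<and> \<phi> \<in> mod_hom L M T \<and> bij_betw \<phi> (carrier M) (carrier T)"
proof -
  interpret M: left_module L M using M by (simp add: fg_module_def)
  obtain \<phi> :: "'m \<Rightarrow> 'r list" where inj: "inj_on \<phi> (carrier M)"
    using M.fin_gen_list_inj M by (auto simp: fg_module_def)
  define \<psi> where "\<psi> = inv_into (carrier M) \<phi>"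
  define T :: "'r test_module" where
    "T = \<lparr>carrier = \<phi> ` carrier M, monoid.mult = undefined, monoid.one = undefined,
          ring.zero = \<phi> \<zero>\<^bsub>M\<^esub>, ring.add = (\<lambda>x y. \<phi> (\<psi> x \<oplus>\<^bsub>M\<^esub> \<psi> y)), smult = (\<lambda>r x. \<phi> (r \<odot>\<^bsub>M\<^esub> \<psi> x))\<rparr>"
  have T: "carrier T = \<phi> ` carrier M" "\<zero>\<^bsub>T\<^esub> = \<phi> \<zero>\<^bsub>M\<^esub>"
    "x \<oplus>\<^bsub>T\<^esub> y = \<phi> (\<psi> x \<oplus>\<^bsub>M\<^esub> \<psi> y)" "r \<odot>\<^bsub>T\<^esub> x = \<phi> (r \<odot>\<^bsub>M\<^esub> \<psi> x)" for x y r
    by (auto simp: T_def)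
  have [simp]: "\<psi> (\<phi> x) = x" if "x \<in> carrier M" for x
    using inj that by (simp add: \<psi>_def)
  have "abelian_group T"
  proof (rule abelian_groupI)
    show "\<exists>y\<in>carrier T. y \<oplus>\<^bsub>T\<^esub> x = \<zero>\<^bsub>T\<^esub>" if "x \<in> carrier T" for x
    proof -
      from that have "x \<in> \<phi> ` carrier M" by (simp only: T(1))
      then obtain m where "x = \<phi> m" "m \<in> carrier M" by (rule imageE)
      then show ?thesis
        by (intro bexI[of _ "\<phi> (\<ominus>\<^bsub>M\<^esub> m)"]) (auto simp: T M.M.l_neg)
    qed
  qed (auto simp: T M.M.a_ac)
  then have lm: "left_module L T"
    by (intro left_module.intro left_module_axioms.intro M.ring_axioms)
       (auto simp: T M.lm_smult_closed M.lm_smult_l_distr M.lm_smult_r_distr M.lm_smult_assoc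
          M.lm_smult_one)
  have hom: "\<phi> \<in> mod_hom L M T"
    by (rule mod_homI) (auto simp: T)
  have "fg_module L T"
    by (rule fg_module_transport[OF M hom _ lm]) (simp add: T)
  then show ?thesis
    using hom inj T(1) by (intro exI[of _ T] exI[of _ \<phi>]) (simp add: bij_betw_def)
qed


section \<open>Homological notions in the category of finitely generated modules\<close>

definition short_exact ::
  "('r, 'z) ring_scheme \<Rightarrow> ('r, 'c) module \<Rightarrow> ('c \<Rightarrow> 'b) \<Rightarrow> ('r, 'b) module
    \<Rightarrow> ('b \<Rightarrow> 'a) \<Rightarrow> ('r, 'a) module \<Rightarrow> bool" where
  "short_exact L C f B g A \<longleftrightarrow>
     fg_module L C \<and> fg_module L B \<and> fg_module L A \<and>
     f \<in> mod_hom L C B \<and> g \<in> mod_hom L B A \<and>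
     inj_on f (carrier C) \<and>
     f ` carrier C = {b \<in> carrier B. g b = \<zero>\<^bsub>A\<^esub>} \<and>
     g ` carrier B = carrier A"

definition split_epi ::
  "('r, 'z) ring_scheme \<Rightarrow> ('r, 'b) module \<Rightarrow> ('b \<Rightarrow> 'a) \<Rightarrow> ('r, 'a) module \<Rightarrow> bool" where
  "split_epi L B g A \<longleftrightarrow>
     g \<in> mod_hom L B A \<and> (\<exists>t\<in>mod_hom L A B. \<forall>x\<in>carrier A. g (t x) = x)"

definition split_mono ::
  "('r, 'z) ring_scheme \<Rightarrow> ('r, 'c) module \<Rightarrow> ('c \<Rightarrow> 'b) \<Rightarrow> ('r, 'b) module \<Rightarrow> bool" where
  "split_mono L C f B \<longleftrightarrow>
     f \<in> mod_hom L C B \<and> (\<exists>t\<in>mod_hom L B C. \<forall>x\<in>carrier C. t (f x) = x)"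

definition right_almost_split ::
  "('r, 'z) ring_scheme \<Rightarrow> ('r, 'b) module \<Rightarrow> ('b \<Rightarrow> 'a) \<Rightarrow> ('r, 'a) module \<Rightarrow> bool" where
  "right_almost_split L B g A \<longleftrightarrow>
     g \<in> mod_hom L B A \<and> \<not> split_epi L B g A \<and>
     (\<forall>(M :: 'r test_module) h. fg_module L M \<and> h \<in> mod_hom L M A \<and> \<not> split_epi L M h A
        \<longrightarrow> (\<exists>t\<in>mod_hom L M B. \<forall>x\<in>carrier M. g (t x) = h x))"

definition left_almost_split ::
  "('r, 'z) ring_scheme \<Rightarrow> ('r, 'c) module \<Rightarrow> ('c \<Rightarrow> 'b) \<Rightarrow> ('r, 'b) module \<Rightarrow> bool" where
  "left_almost_split L C f B \<longleftrightarrow>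
     f \<in> mod_hom L C B \<and> \<not> split_mono L C f B \<and>
     (\<forall>(M :: 'r test_module) h. fg_module L M \<and> h \<in> mod_hom L C M \<and> \<not> split_mono L C h M
        \<longrightarrow> (\<exists>t\<in>mod_hom L B M. \<forall>x\<in>carrier C. t (f x) = h x))"

definition almost_split_seq ::
  "('r, 'z) ring_scheme \<Rightarrow> ('r, 'c) module \<Rightarrow> ('c \<Rightarrow> 'b) \<Rightarrow> ('r, 'b) module
    \<Rightarrow> ('b \<Rightarrow> 'a) \<Rightarrow> ('r, 'a) module \<Rightarrow> bool" where
  "almost_split_seq L C f B g A \<longleftrightarrow>
     short_exact L C f B g A \<and> left_almost_split L C f B \<and> right_almost_split L B g A"

definition indecomposable :: "('r, 'z) ring_scheme \<Rightarrow> ('r, 'a) module \<Rightarrow> bool" where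
  "indecomposable L A \<longleftrightarrow>
     carrier A \<noteq> {\<zero>\<^bsub>A\<^esub>} \<and>
     (\<forall>H K. submodule H L A \<and> submodule K L A \<and> H \<inter> K = {\<zero>\<^bsub>A\<^esub>} \<and> H <+>\<^bsub>A\<^esub> K = carrier A
        \<longrightarrow> H = {\<zero>\<^bsub>A\<^esub>} \<or> K = {\<zero>\<^bsub>A\<^esub>})"

definition projective :: "('r, 'z) ring_scheme \<Rightarrow> ('r, 'p) module \<Rightarrow> bool" where
  "projective L P \<longleftrightarrow>
     fg_module L P \<and>
     (\<forall>(M :: 'r test_module) (N :: 'r test_module) g h.
        fg_module L M \<and> fg_module L N \<and> g \<in> mod_hom L M N \<and> g ` carrier M = carrier N \<and>
        h \<in> mod_hom L P N
        \<longrightarrow> (\<exists>t\<in>mod_hom L P M. \<forall>x\<in>carrier P. g (t x) = h x))"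

definition injective :: "('r, 'z) ring_scheme \<Rightarrow> ('r, 'i) module \<Rightarrow> bool" where
  "injective L I \<longleftrightarrow>
     fg_module L I \<and>
     (\<forall>(M :: 'r test_module) (N :: 'r test_module) f h.
        fg_module L M \<and> fg_module L N \<and> f \<in> mod_hom L M N \<and> inj_on f (carrier M) \<and>
        h \<in> mod_hom L M I
        \<longrightarrow> (\<exists>t\<in>mod_hom L N I. \<forall>x\<in>carrier M. t (f x) = h x))"

text \<open>The last conjunct of \<open>projective_cover\<close> says that the kernel of \<open>p\<close> is superfluous in \<open>P\<close>,
  that of \<open>injective_envelope\<close> that the image of \<open>e\<close> is essential in \<open>I\<close>.\<close>

definition projective_cover ::
  "('r, 'z) ring_scheme \<Rightarrow> ('r, 'p) module \<Rightarrow> ('p \<Rightarrow> 'a) \<Rightarrow> ('r, 'a) module \<Rightarrow> bool" where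
  "projective_cover L P p A \<longleftrightarrow>
     projective L P \<and> p \<in> mod_hom L P A \<and> p ` carrier P = carrier A \<and>
     (\<forall>H. submodule H L P \<and> H <+>\<^bsub>P\<^esub> {x \<in> carrier P. p x = \<zero>\<^bsub>A\<^esub>} = carrier P
        \<longrightarrow> H = carrier P)"

definition injective_envelope ::
  "('r, 'z) ring_scheme \<Rightarrow> ('r, 'c) module \<Rightarrow> ('c \<Rightarrow> 'i) \<Rightarrow> ('r, 'i) module \<Rightarrow> bool" where
  "injective_envelope L C e I \<longleftrightarrow>
     injective L I \<and> e \<in> mod_hom L C I \<and> inj_on e (carrier C) \<and>
     (\<forall>H. submodule H L I \<and> H \<inter> e ` carrier C = {\<zero>\<^bsub>I\<^esub>} \<longrightarrow> H = {\<zero>\<^bsub>I\<^esub>})"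

text \<open>\<open>pullback L Z h l B g P p A\<close>: the square with \<open>h : Z \<rightarrow> B\<close>, \<open>l : Z \<rightarrow> P\<close>,
  \<open>g : B \<rightarrow> A\<close>, \<open>p : P \<rightarrow> A\<close> is cartesian.\<close>

definition pullback ::
  "('r, 'z) ring_scheme \<Rightarrow> ('r, 'w) module \<Rightarrow> ('w \<Rightarrow> 'b) \<Rightarrow> ('w \<Rightarrow> 'p)
    \<Rightarrow> ('r, 'b) module \<Rightarrow> ('b \<Rightarrow> 'a) \<Rightarrow> ('r, 'p) module \<Rightarrow> ('p \<Rightarrow> 'a) \<Rightarrow> ('r, 'a) module \<Rightarrow> bool"
  where
  "pullback L Z h l B g P p A \<longleftrightarrow>
     fg_module L Z \<and> h \<in> mod_hom L Z B \<and> l \<in> mod_hom L Z P \<and>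
     (\<forall>z\<in>carrier Z. g (h z) = p (l z)) \<and>
     (\<forall>(M :: 'r test_module) a b.
        fg_module L M \<and> a \<in> mod_hom L M B \<and> b \<in> mod_hom L M P \<and>
        (\<forall>x\<in>carrier M. g (a x) = p (b x))
        \<longrightarrow> (\<exists>t\<in>mod_hom L M Z.
               (\<forall>x\<in>carrier M. h (t x) = a x \<and> l (t x) = b x) \<and>
               (\<forall>t'\<in>mod_hom L M Z. (\<forall>x\<in>carrier M. h (t' x) = a x \<and> l (t' x) = b x)
                  \<longrightarrow> (\<forall>x\<in>carrier M. t' x = t x))))"

text \<open>\<open>pushout L C f B e I d u Y\<close>: the square with \<open>f : C \<rightarrow> B\<close>, \<open>e : C \<rightarrow> I\<close>,
  \<open>d : B \<rightarrow> Y\<close>, \<open>u : I \<rightarrow> Y\<close> is cocartesian.\<close>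

definition pushout ::
  "('r, 'z) ring_scheme \<Rightarrow> ('r, 'c) module \<Rightarrow> ('c \<Rightarrow> 'b) \<Rightarrow> ('r, 'b) module
    \<Rightarrow> ('c \<Rightarrow> 'i) \<Rightarrow> ('r, 'i) module \<Rightarrow> ('b \<Rightarrow> 'y) \<Rightarrow> ('i \<Rightarrow> 'y) \<Rightarrow> ('r, 'y) module \<Rightarrow> bool"
  where
  "pushout L C f B e I d u Y \<longleftrightarrow>
     fg_module L Y \<and> d \<in> mod_hom L B Y \<and> u \<in> mod_hom L I Y \<and>
     (\<forall>c\<in>carrier C. d (f c) = u (e c)) \<and>
     (\<forall>(M :: 'r test_module) a b.
        fg_module L M \<and> a \<in> mod_hom L B M \<and> b \<in> mod_hom L I M \<and>
        (\<forall>c\<in>carrier C. a (f c) = b (e c))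
        \<longrightarrow> (\<exists>t\<in>mod_hom L Y M.
               (\<forall>y\<in>carrier B. t (d y) = a y) \<and> (\<forall>y\<in>carrier I. t (u y) = b y) \<and>
               (\<forall>t'\<in>mod_hom L Y M.
                  (\<forall>y\<in>carrier B. t' (d y) = a y) \<and> (\<forall>y\<in>carrier I. t' (u y) = b y)
                  \<longrightarrow> (\<forall>x\<in>carrier Y. t' x = t x))))"

text \<open>\<open>0 \<rightarrow> C \<rightarrow> Z \<rightarrow> P \<rightarrow> 0\<close> (maps \<open>s\<close>, \<open>l\<close>) is the pull-back of
  \<open>0 \<rightarrow> C \<rightarrow> B \<rightarrow> A \<rightarrow> 0\<close> (maps \<open>f\<close>, \<open>g\<close>) along \<open>p : P \<rightarrow> A\<close>, with induced map
  \<open>h : Z \<rightarrow> B\<close>; dually for the push-out along \<open>e : C \<rightarrow> I\<close>.\<close>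

definition pullback_seq where
  "pullback_seq L C f B g A P p s Z l h \<longleftrightarrow>
     short_exact L C s Z l P \<and> pullback L Z h l B g P p A \<and> (\<forall>c\<in>carrier C. h (s c) = f c)"

definition pushout_seq where
  "pushout_seq L C f B g A I e u Y v d \<longleftrightarrow>
     short_exact L I u Y v A \<and> pushout L C f B e I d u Y \<and> (\<forall>b\<in>carrier B. v (d b) = g b)"


section \<open>The morphism category and triangular matrices\<close>

text \<open>An object \<open>(A, f, B)\<close> of the morphism category stands for \<open>f : A \<rightarrow> B\<close>.\<close>

type_synonym ('r, 'a, 'b) mor_obj = "('r, 'a) module \<times> ('a \<Rightarrow> 'b) \<times> ('r, 'b) module"

fun mor_object :: "('r, 'z) ring_scheme \<Rightarrow> ('r, 'a, 'b) mor_obj \<Rightarrow> bool" where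
  "mor_object L (A, f, B) \<longleftrightarrow> fg_module L A \<and> fg_module L B \<and> f \<in> mod_hom L A B"

fun mor_hom ::
  "('r, 'z) ring_scheme \<Rightarrow> ('r, 'a, 'b) mor_obj \<Rightarrow> ('r, 'c, 'd) mor_obj
    \<Rightarrow> (('a \<Rightarrow> 'c) \<times> ('b \<Rightarrow> 'd)) set" where
  "mor_hom L (A, f, B) (C, g, D) =
     {(h1, h2). h1 \<in> mod_hom L A C \<and> h2 \<in> mod_hom L B D \<and>
        (\<forall>x\<in>carrier A. g (h1 x) = h2 (f x))}"

text \<open>The triple \<open>(x, y, z)\<close> stands for the upper triangular matrix with first row \<open>x\<close>, \<open>y\<close>
  and second row \<open>0\<close>, \<open>z\<close>.\<close>

definition T2 :: "('r, 'z) ring_scheme \<Rightarrow> ('r \<times> 'r \<times> 'r) ring" where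
  "T2 L = \<lparr>carrier = carrier L \<times> carrier L \<times> carrier L,
     monoid.mult = (\<lambda>(x, y, z) (x', y', z').
       (x \<otimes>\<^bsub>L\<^esub> x', x \<otimes>\<^bsub>L\<^esub> y' \<oplus>\<^bsub>L\<^esub> y \<otimes>\<^bsub>L\<^esub> z', z \<otimes>\<^bsub>L\<^esub> z')),
     monoid.one = (\<one>\<^bsub>L\<^esub>, \<zero>\<^bsub>L\<^esub>, \<one>\<^bsub>L\<^esub>),
     ring.zero = (\<zero>\<^bsub>L\<^esub>, \<zero>\<^bsub>L\<^esub>, \<zero>\<^bsub>L\<^esub>),
     ring.add = (\<lambda>(x, y, z) (x', y', z'). (x \<oplus>\<^bsub>L\<^esub> x', y \<oplus>\<^bsub>L\<^esub> y', z \<oplus>\<^bsub>L\<^esub> z'))\<rparr>"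

lemma T2_simps [simp]:
  "carrier (T2 L) = carrier L \<times> carrier L \<times> carrier L"
  "(x, y, z) \<otimes>\<^bsub>T2 L\<^esub> (x', y', z') =
     (x \<otimes>\<^bsub>L\<^esub> x', x \<otimes>\<^bsub>L\<^esub> y' \<oplus>\<^bsub>L\<^esub> y \<otimes>\<^bsub>L\<^esub> z', z \<otimes>\<^bsub>L\<^esub> z')"
  "\<one>\<^bsub>T2 L\<^esub> = (\<one>\<^bsub>L\<^esub>, \<zero>\<^bsub>L\<^esub>, \<one>\<^bsub>L\<^esub>)"
  "\<zero>\<^bsub>T2 L\<^esub> = (\<zero>\<^bsub>L\<^esub>, \<zero>\<^bsub>L\<^esub>, \<zero>\<^bsub>L\<^esub>)"
  "(x, y, z) \<oplus>\<^bsub>T2 L\<^esub> (x', y', z') = (x \<oplus>\<^bsub>L\<^esub> x', y \<oplus>\<^bsub>L\<^esub> y', z \<oplus>\<^bsub>L\<^esub> z')"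
  by (simp_all add: T2_def)

lemma T2_ring:
  assumes "ring L"
  shows "ring (T2 L)"
proof -
  interpret ring L by (rule assms)
  show ?thesis
  proof (rule ringI)
    show "abelian_group (T2 L)"
    proof (rule abelian_groupI)
      show "\<exists>w\<in>carrier (T2 L). w \<oplus>\<^bsub>T2 L\<^esub> t = \<zero>\<^bsub>T2 L\<^esub>" if "t \<in> carrier (T2 L)" for t
      proof -
        obtain x y z where "t = (x, y, z)" by (cases t)
        then show ?thesis
          using that by (intro bexI[of _ "(\<ominus>\<^bsub>L\<^esub> x, \<ominus>\<^bsub>L\<^esub> y, \<ominus>\<^bsub>L\<^esub> z)"]) (auto simp: l_neg)
      qed
    qed (auto simp: a_ac)
    show "monoid (T2 L)"
      by (rule monoidI) (auto simp: m_assoc l_distr r_distr a_assoc)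
  qed (auto simp: l_distr r_distr a_ac)
qed

text \<open>The equivalence from the morphism category to modules over triangular matrices: the object
  \<open>f : A \<rightarrow> B\<close> goes to the module of column vectors with upper entry in \<open>B\<close> and lower entry in
  \<open>A\<close>, where a matrix acts by the usual rule, the upper right entry \<open>y\<close> sending \<open>a\<close> to
  \<open>y f(a)\<close>.\<close>

fun tri_module :: "('r, 'a, 'b) mor_obj \<Rightarrow> ('r \<times> 'r \<times> 'r, 'b \<times> 'a) module" where
  "tri_module (A, f, B) =
     \<lparr>carrier = carrier B \<times> carrier A, monoid.mult = undefined, monoid.one = undefined,
      ring.zero = (\<zero>\<^bsub>B\<^esub>, \<zero>\<^bsub>A\<^esub>),
      ring.add = (\<lambda>(b, a) (b', a'). (b \<oplus>\<^bsub>B\<^esub> b', a \<oplus>\<^bsub>A\<^esub> a')),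
      smult = (\<lambda>(x, y, z) (b, a). (x \<odot>\<^bsub>B\<^esub> b \<oplus>\<^bsub>B\<^esub> y \<odot>\<^bsub>B\<^esub> f a, z \<odot>\<^bsub>A\<^esub> a))\<rparr>"

fun tri_map :: "('a \<Rightarrow> 'c) \<times> ('b \<Rightarrow> 'd) \<Rightarrow> 'b \<times> 'a \<Rightarrow> 'd \<times> 'c" where
  "tri_map (h1, h2) = map_prod h2 h1"

lemma tri_module_simps:
  "carrier (tri_module (A, f, B)) = carrier B \<times> carrier A"
  "\<zero>\<^bsub>tri_module (A, f, B)\<^esub> = (\<zero>\<^bsub>B\<^esub>, \<zero>\<^bsub>A\<^esub>)"
  "(b, a) \<oplus>\<^bsub>tri_module (A, f, B)\<^esub> (b', a') = (b \<oplus>\<^bsub>B\<^esub> b', a \<oplus>\<^bsub>A\<^esub> a')"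
  "(x, y, z) \<odot>\<^bsub>tri_module (A, f, B)\<^esub> (b, a) =
     (x \<odot>\<^bsub>B\<^esub> b \<oplus>\<^bsub>B\<^esub> y \<odot>\<^bsub>B\<^esub> f a, z \<odot>\<^bsub>A\<^esub> a)"
  by simp_all

lemma mod_homD:
  assumes "f \<in> mod_hom L M N"
  shows "x \<in> carrier M \<Longrightarrow> f x \<in> carrier N"
    and "\<lbrakk>x \<in> carrier M; y \<in> carrier M\<rbrakk> \<Longrightarrow> f (x \<oplus>\<^bsub>M\<^esub> y) = f x \<oplus>\<^bsub>N\<^esub> f y"
    and "\<lbrakk>r \<in> carrier L; x \<in> carrier M\<rbrakk> \<Longrightarrow> f (r \<odot>\<^bsub>M\<^esub> x) = r \<odot>\<^bsub>N\<^esub> f x"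
  using assms by (auto simp: mod_hom_def hom_def)

lemma mod_hom_zero:
  assumes "f \<in> mod_hom L M N" "left_module L M" "left_module L N"
  shows "f \<zero>\<^bsub>M\<^esub> = \<zero>\<^bsub>N\<^esub>"
proof -
  interpret M: left_module L M by (rule assms)
  interpret N: left_module L N by (rule assms)
  have "f (\<zero>\<^bsub>L\<^esub> \<odot>\<^bsub>M\<^esub> \<zero>\<^bsub>M\<^esub>) = \<zero>\<^bsub>L\<^esub> \<odot>\<^bsub>N\<^esub> f \<zero>\<^bsub>M\<^esub>"
    using mod_homD(3)[OF assms(1)] by blast
  then show ?thesis
    using mod_homD(1)[OF assms(1)] by (simp add: M.lm_smult_l_null N.lm_smult_l_null)
qed

lemma tri_module_left_module:
  assumes A: "left_module L A" and B: "left_module L B" and f: "f \<in> mod_hom L A B"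
  shows "left_module (T2 L) (tri_module (A, f, B))"
proof -
  interpret A: left_module L A by (rule A)
  interpret B: left_module L B by (rule B)
  note [simp] = mod_homD[OF f] A.lm_smult_closed B.lm_smult_closed
  let ?T = "tri_module (A, f, B)"
  have "abelian_group ?T"
  proof (rule abelian_groupI)
    show "\<exists>w\<in>carrier ?T. w \<oplus>\<^bsub>?T\<^esub> t = \<zero>\<^bsub>?T\<^esub>" if "t \<in> carrier ?T" for t
    proof -
      obtain b a where "t = (b, a)" by (cases t)
      then show ?thesis
        using that by (intro bexI[of _ "(\<ominus>\<^bsub>B\<^esub> b, \<ominus>\<^bsub>A\<^esub> a)"]) (auto simp: A.M.l_neg B.M.l_neg)
    qed
  qed (auto simp: A.M.a_ac B.M.a_ac)
  then show ?thesis
  proof (intro left_module.intro left_module_axioms.intro T2_ring A.ring_axioms)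
    fix r q t w
    assume r: "r \<in> carrier (T2 L)" and t: "t \<in> carrier ?T"
    obtain x y z where r': "r = (x, y, z)" "x \<in> carrier L" "y \<in> carrier L" "z \<in> carrier L"
      using r by (cases r) auto
    obtain b a where t': "t = (b, a)" "b \<in> carrier B" "a \<in> carrier A"
      using t by (cases t) auto
    show "r \<odot>\<^bsub>?T\<^esub> t \<in> carrier ?T"
      using r' t' by simp
    show "r \<odot>\<^bsub>?T\<^esub> (t \<oplus>\<^bsub>?T\<^esub> w) = r \<odot>\<^bsub>?T\<^esub> t \<oplus>\<^bsub>?T\<^esub> r \<odot>\<^bsub>?T\<^esub> w" if w: "w \<in> carrier ?T"
    proof -
      obtain b' a' where "w = (b', a')" "b' \<in> carrier B" "a' \<in> carrier A"
        using w by (cases w) auto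
      then show ?thesis
        using r' t' by (simp add: A.lm_smult_r_distr B.lm_smult_r_distr B.M.add.m_ac)
    qed
    assume q: "q \<in> carrier (T2 L)"
    obtain x' y' z' where q': "q = (x', y', z')" "x' \<in> carrier L" "y' \<in> carrier L" "z' \<in> carrier L"
      using q by (cases q) auto
    show "(r \<oplus>\<^bsub>T2 L\<^esub> q) \<odot>\<^bsub>?T\<^esub> t = r \<odot>\<^bsub>?T\<^esub> t \<oplus>\<^bsub>?T\<^esub> q \<odot>\<^bsub>?T\<^esub> t"
      using r' q' t' by (simp add: A.lm_smult_l_distr B.lm_smult_l_distr B.M.add.m_ac)
    show "(r \<otimes>\<^bsub>T2 L\<^esub> q) \<odot>\<^bsub>?T\<^esub> t = r \<odot>\<^bsub>?T\<^esub> (q \<odot>\<^bsub>?T\<^esub> t)"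
      using r' q' t'
      by (simp add: A.lm_smult_assoc B.lm_smult_assoc B.lm_smult_l_distr B.lm_smult_r_distr
          B.M.add.m_assoc)
  next
    fix t assume "t \<in> carrier ?T"
    then show "\<one>\<^bsub>T2 L\<^esub> \<odot>\<^bsub>?T\<^esub> t = t"
      by (cases t) (auto simp: A.lm_smult_one B.lm_smult_one B.lm_smult_l_null)
  qed
qed

lemma tri_map_mod_hom:
  assumes "mor_object L (A, f, B)" "mor_object L (C, g, D)"
    and "\<phi> \<in> mor_hom L (A, f, B) (C, g, D)"
  shows "tri_map \<phi> \<in> mod_hom (T2 L) (tri_module (A, f, B)) (tri_module (C, g, D))"
proof -
  interpret A: left_module L A using assms(1) by (simp add: fg_module_def)
  interpret B: left_module L B using assms(1) by (simp add: fg_module_def)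
  obtain h1 h2 where \<phi>: "\<phi> = (h1, h2)" "h1 \<in> mod_hom L A C" "h2 \<in> mod_hom L B D"
    "\<And>x. x \<in> carrier A \<Longrightarrow> g (h1 x) = h2 (f x)"
    using assms(3) by (cases \<phi>) auto
  have f: "f \<in> mod_hom L A B" using assms(1) by simp
  note [simp] = mod_homD[OF f] mod_homD[OF \<phi>(2)] mod_homD[OF \<phi>(3)] B.lm_smult_closed
    A.lm_smult_closed
  show ?thesis
    by (rule mod_homI) (auto simp: \<phi>)
qed

text \<open>A sequence in the morphism category is almost split if its image under the equivalence is an
  almost split sequence of modules over the triangular matrix ring.\<close>

definition mor_almost_split_seq ::
  "('r, 'z) ring_scheme \<Rightarrow> ('r, 'c1, 'c2) mor_obj \<Rightarrow> ('c1 \<Rightarrow> 'b1) \<times> ('c2 \<Rightarrow> 'b2)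
    \<Rightarrow> ('r, 'b1, 'b2) mor_obj \<Rightarrow> ('b1 \<Rightarrow> 'a1) \<times> ('b2 \<Rightarrow> 'a2) \<Rightarrow> ('r, 'a1, 'a2) mor_obj \<Rightarrow> bool"
  where
  "mor_almost_split_seq L C \<phi> B \<psi> A \<longleftrightarrow>
     mor_object L C \<and> mor_object L B \<and> mor_object L A \<and>
     \<phi> \<in> mor_hom L C B \<and> \<psi> \<in> mor_hom L B A \<and>
     almost_split_seq (T2 L) (tri_module C) (tri_map \<phi>) (tri_module B) (tri_map \<psi>) (tri_module A)"

end

theory Submission
  imports Defs
begin

text \<open>
  Since \<open>P\<close> is projective and \<open>I\<close> is injective, \<open>l\<close> and \<open>v\<close> are split epimorphisms, and only the
  compatibility with the structure maps of the objects matters. Let \<open>(k1, k2)\<close> be a morphism from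
  \<open>m : M \<rightarrow> N\<close> to \<open>p : P \<rightarrow> A\<close>, and restrict \<open>k2\<close> to the image \<open>K\<close> of \<open>m\<close>. If this restriction
  is a split epimorphism, its section lifts along \<open>M \<rightarrow> K\<close> to \<open>P \<rightarrow> M\<close>, and since \<open>ker p\<close> is
  superfluous \<open>(k1, k2)\<close> splits as well. Otherwise it factors through \<open>g\<close>; the factorization
  \<open>w : K \<rightarrow> B\<close> gives \<open>M \<rightarrow> Z\<close> by the pull-back property, and \<open>d w\<close> extends to \<open>N \<rightarrow> Y\<close>
  because \<open>I\<close> is injective. The left almost split property is dual, again through the image of \<open>m\<close>.
  Finally \<open>(l, v)\<close> is not split, since \<open>d\<close> is injective: a section \<open>(t1, t2)\<close> would make \<open>h t1\<close>
  vanish on \<open>ker p\<close> and so induce a section of \<open>g\<close>.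
\<close>

section \<open>Homomorphisms\<close>

text \<open>The image \<open>K\<close> of \<open>m\<close> is forced. In a section
  \<open>(t1, t2)\<close> of \<open>(k1, k2)\<close> one has \<open>m t1 = t2 p\<close> with
  \<open>p\<close> onto, so \<open>t2\<close> takes its values in \<open>K\<close>; a section of
  \<open>k2\<close> that leaves \<open>K\<close> cannot be part of a pair. Dually, for a retraction
  \<open>(t1, t2)\<close> onto \<open>(C, e, I)\<close>, the equation \<open>e t1 = t2 m\<close>
  with \<open>e\<close> injective makes \<open>t1\<close> constant on the fibres of
  \<open>m\<close>, so it factors through \<open>K\<close>. Two obstacles shape the rest. The
  universal properties in the definitions are tested only against modules of lists of scalars,
  whereas the modules of the diagram have unrelated carrier types; lifting properties are therefore
  transported along isomorphic copies or rederived elementwise from the exact rows. Moreover, almost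
  split sequences live over \<open>T2 L\<close>, so the passage from pairs of maps needs
  \<open>tri_module\<close> to be full and dense, with finite generation preserved in both
  directions.\<close>

lemma fg_left_module: "fg_module L M \<Longrightarrow> left_module L M"
  by (simp add: fg_module_def)

lemma mod_hom_id: "(\<lambda>x. x) \<in> mod_hom L M M"
  by (rule mod_homI) simp_all

lemma mod_hom_comp:
  assumes "f \<in> mod_hom L M N" "g \<in> mod_hom L N K"
  shows "(\<lambda>x. g (f x)) \<in> mod_hom L M K"
  by (rule mod_homI) (simp_all add: mod_homD[OF assms(1)] mod_homD[OF assms(2)])

lemma mod_hom_minus:
  assumes f: "f \<in> mod_hom L M N" and M: "left_module L M" and N: "left_module L N"
    and x: "x \<in> carrier M" "y \<in> carrier M"
  shows "f (x \<ominus>\<^bsub>M\<^esub> y) = f x \<ominus>\<^bsub>N\<^esub> f y"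
proof -
  interpret M: left_module L M by (rule M)
  interpret N: left_module L N by (rule N)
  show ?thesis
    using x by (simp add: a_minus_def mod_homD[OF f] M.lm_minus N.lm_minus M.lm_smult_closed)
qed

lemma mod_hom_diff_eq_zero:
  assumes f: "f \<in> mod_hom L M N" and M: "left_module L M" and N: "left_module L N"
    and x: "x \<in> carrier M" "y \<in> carrier M" and eq: "f x = f y"
  shows "f (x \<ominus>\<^bsub>M\<^esub> y) = \<zero>\<^bsub>N\<^esub>"
proof -
  interpret N: left_module L N by (rule N)
  show ?thesis
    using mod_hom_minus[OF f M N x] mod_homD(1)[OF f x(2)] by (simp add: eq a_minus_def N.M.r_neg)
qed

lemma (in abelian_group) eq_if_diff_eq_zero:
  assumes "x \<ominus> y = \<zero>" "x \<in> carrier G" "y \<in> carrier G"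
  shows "x = y"
  using minus_equality[of x "\<ominus> y"] assms by (simp add: a_minus_def)

lemma (in abelian_group) add_diff_cancel:
  assumes "x \<in> carrier G" "y \<in> carrier G"
  shows "x \<oplus> (y \<ominus> x) = y"
  using assms a_lcomm[of x y "\<ominus> x"] by (simp add: a_minus_def r_neg)

section \<open>Homomorphisms given by their graphs; lifting and factorization\<close>

text \<open>Choice picks a value for each argument, and \<open>single\<close> forces the chosen
  values to respect sums and scalars. The lifts and extensions below are characterized by conditions
  rather than by formulas; building them from their graphs avoids forming product and quotient
  modules.\<close>

lemma mod_hom_of_graph:
  assumes total: "\<And>x. x \<in> carrier M \<Longrightarrow> \<exists>y\<in>carrier N. G x y"
    and single: "\<And>x y z. \<lbrakk>x \<in> carrier M; y \<in> carrier N; z \<in> carrier N; G x y; G x z\<rbrakk> \<Longrightarrow> y = z"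
    and add: "\<And>x x' y y'. \<lbrakk>x \<in> carrier M; x' \<in> carrier M; y \<in> carrier N; y' \<in> carrier N;
      G x y; G x' y'\<rbrakk> \<Longrightarrow> G (x \<oplus>\<^bsub>M\<^esub> x') (y \<oplus>\<^bsub>N\<^esub> y')"
    and smult: "\<And>r x y. \<lbrakk>r \<in> carrier L; x \<in> carrier M; y \<in> carrier N; G x y\<rbrakk>
      \<Longrightarrow> G (r \<odot>\<^bsub>M\<^esub> x) (r \<odot>\<^bsub>N\<^esub> y)"
    and M: "left_module L M" and N: "left_module L N"
  obtains w where "w \<in> mod_hom L M N" "\<And>x. x \<in> carrier M \<Longrightarrow> G x (w x)"
    "\<And>x y. \<lbrakk>x \<in> carrier M; y \<in> carrier N; G x y\<rbrakk> \<Longrightarrow> w x = y"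
proof -
  interpret M: left_module L M by (rule M)
  interpret N: left_module L N by (rule N)
  define w where "w x = (SOME y. y \<in> carrier N \<and> G x y)" for x
  have w: "w x \<in> carrier N" "G x (w x)" if "x \<in> carrier M" for x
    using someI_ex[of "\<lambda>y. y \<in> carrier N \<and> G x y"] total[OF that] by (auto simp: w_def)
  have eq: "w x = y" if "x \<in> carrier M" "y \<in> carrier N" "G x y" for x y
    using single w that by blast
  have "w \<in> mod_hom L M N"
    by (rule mod_homI)
      (auto intro!: w eq add smult M.lm_smult_closed N.lm_smult_closed)
  then show thesis using w eq that by blast
qed

lemma mod_hom_lift_inj:
  assumes j: "j \<in> mod_hom L N K" "inj_on j (carrier N)" and w: "w \<in> mod_hom L M K"
    and image: "\<And>x. x \<in> carrier M \<Longrightarrow> w x \<in> j ` carrier N"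
    and M: "left_module L M" and N: "left_module L N"
  obtains t where "t \<in> mod_hom L M N" "\<And>x. x \<in> carrier M \<Longrightarrow> j (t x) = w x"
proof (rule mod_hom_of_graph[OF _ _ _ _ M N, of "\<lambda>x y. j y = w x"])
  show "\<exists>y\<in>carrier N. j y = w x" if "x \<in> carrier M" for x
    using image[OF that] by (metis imageE)
  show "y = z" if "y \<in> carrier N" "z \<in> carrier N" "j y = w x" "j z = w x" for x y z
    using inj_onD[OF j(2)] that by simp
qed (use that in \<open>simp_all add: mod_homD[OF j(1)] mod_homD[OF w]\<close>)

text \<open>The value at \<open>q x\<close> is read off from any preimage. \<open>compatible\<close>
  says that the kernel of \<open>q\<close> lies in that of \<open>w\<close>, in fibre form so that
  it can be checked through injectivity of another map, as in \<open>not_split_epi\<close>.\<close>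

lemma mod_hom_factor_surj:
  assumes q: "q \<in> mod_hom L M K" "q ` carrier M = carrier K" and w: "w \<in> mod_hom L M N"
    and compatible: "\<And>x y. \<lbrakk>x \<in> carrier M; y \<in> carrier M; q x = q y\<rbrakk> \<Longrightarrow> w x = w y"
    and M: "left_module L M" and K: "left_module L K" and N: "left_module L N"
  obtains t where "t \<in> mod_hom L K N" "\<And>x. x \<in> carrier M \<Longrightarrow> t (q x) = w x"
proof (rule mod_hom_of_graph[OF _ _ _ _ K N, of "\<lambda>y z. \<exists>x\<in>carrier M. q x = y \<and> w x = z"])
  note thesisI = that
  interpret M: left_module L M by (rule M)
  show "\<exists>z\<in>carrier N. \<exists>x\<in>carrier M. q x = y \<and> w x = z" if "y \<in> carrier K" for y
    using that q(2) mod_homD(1)[OF w] by (metis imageE)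
  show "z = z'" if "\<exists>x\<in>carrier M. q x = y \<and> w x = z" "\<exists>x\<in>carrier M. q x = y \<and> w x = z'" for y z z'
    using that compatible by metis
  show "\<exists>x\<in>carrier M. q x = y \<oplus>\<^bsub>K\<^esub> y' \<and> w x = z \<oplus>\<^bsub>N\<^esub> z'"
    if "\<exists>x\<in>carrier M. q x = y \<and> w x = z" "\<exists>x\<in>carrier M. q x = y' \<and> w x = z'" for y y' z z'
    using that mod_homD(2)[OF q(1)] mod_homD(2)[OF w] M.M.a_closed by metis
  show "\<exists>x\<in>carrier M. q x = r \<odot>\<^bsub>K\<^esub> y \<and> w x = r \<odot>\<^bsub>N\<^esub> z"
    if "r \<in> carrier L" "\<exists>x\<in>carrier M. q x = y \<and> w x = z" for r y z
    using that mod_homD(3)[OF q(1)] mod_homD(3)[OF w] M.lm_smult_closed by metis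
  show thesis if "t \<in> mod_hom L K N"
    "\<And>y z. \<lbrakk>y \<in> carrier K; z \<in> carrier N; \<exists>x\<in>carrier M. q x = y \<and> w x = z\<rbrakk> \<Longrightarrow> t y = z" for t
    using that thesisI mod_homD(1)[OF q(1)] mod_homD(1)[OF w] by blast
qed

lemma mod_hom_inverse:
  assumes f: "f \<in> mod_hom L M N" "bij_betw f (carrier M) (carrier N)"
    and M: "left_module L M" and N: "left_module L N"
  obtains k where "k \<in> mod_hom L N M" "\<And>y. y \<in> carrier N \<Longrightarrow> f (k y) = y"
    "\<And>x. x \<in> carrier M \<Longrightarrow> k (f x) = x"
proof -
  have f': "inj_on f (carrier M)" "f ` carrier M = carrier N"
    using f(2) by (auto simp: bij_betw_def)
  obtain k where k: "k \<in> mod_hom L N M" "\<And>y. y \<in> carrier N \<Longrightarrow> f (k y) = y"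
    using mod_hom_lift_inj[OF f(1) f'(1) mod_hom_id _ N M] f'(2) by blast
  have "k (f x) = x" if "x \<in> carrier M" for x
    using that k(2) inj_onD[OF f'(1)] mod_homD(1)[OF k(1)] mod_homD(1)[OF f(1)] by simp
  then show thesis using k that by blast
qed

text \<open>This pair of inverse maps frees \<open>injective\<close>, \<open>projective\<close> and
  the almost split properties from the test type: conjugate the given maps with it, apply the clause
  of the definition, and conjugate the result back.\<close>

lemma fg_module_test_copy:
  fixes L :: "('r, 'z) ring_scheme"
  assumes "fg_module L M"
  obtains T :: "'r test_module" and \<phi> \<psi> where "fg_module L T" "\<phi> \<in> mod_hom L M T"
    "\<psi> \<in> mod_hom L T M" "\<And>x. x \<in> carrier M \<Longrightarrow> \<psi> (\<phi> x) = x" "\<And>y. y \<in> carrier T \<Longrightarrow> \<phi> (\<psi> y) = y"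
proof -
  obtain T :: "'r test_module" and \<phi> where T: "fg_module L T" "\<phi> \<in> mod_hom L M T"
    "bij_betw \<phi> (carrier M) (carrier T)"
    using fg_module_iso_test_module[OF assms] by blast
  then show thesis
    using mod_hom_inverse[OF T(2,3)] assms that by (metis fg_left_module)
qed

section \<open>Images of homomorphisms as modules\<close>

text \<open>Only the carrier of \<open>N\<close> is shrunk, so the inclusion is the identity
  function and \<open>f\<close> is its own corestriction; maps on \<open>N\<close> restrict without
  any change of the function.\<close>

definition image_module :: "('m \<Rightarrow> 'n) \<Rightarrow> ('r, 'm) module \<Rightarrow> ('r, 'n) module \<Rightarrow> ('r, 'n) module" where
  "image_module f M N = N\<lparr>carrier := f ` carrier M\<rparr>"

lemma image_module_simps [simp]:
  "carrier (image_module f M N) = f ` carrier M"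
  "\<zero>\<^bsub>image_module f M N\<^esub> = \<zero>\<^bsub>N\<^esub>"
  "x \<oplus>\<^bsub>image_module f M N\<^esub> y = x \<oplus>\<^bsub>N\<^esub> y"
  "r \<odot>\<^bsub>image_module f M N\<^esub> x = r \<odot>\<^bsub>N\<^esub> x"
  by (simp_all add: image_module_def)

lemma mod_hom_image_module:
  assumes "f \<in> mod_hom L M N"
  shows "f \<in> mod_hom L M (image_module f M N)" "(\<lambda>x. x) \<in> mod_hom L (image_module f M N) N"
  by (auto intro!: mod_homI simp: mod_homD[OF assms])

text \<open>Finite generation comes from \<open>M\<close>, as a homomorphic image, and not from an
  argument about submodules of \<open>N\<close>.\<close>

lemma fg_image_module:
  assumes M: "fg_module L M" and N: "fg_module L N" and f: "f \<in> mod_hom L M N"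
  shows "fg_module L (image_module f M N)"
proof -
  interpret M: left_module L M using M by (rule fg_left_module)
  interpret N: left_module L N using N by (rule fg_left_module)
  have f0: "f \<zero>\<^bsub>M\<^esub> = \<zero>\<^bsub>N\<^esub>"
    by (rule mod_hom_zero[OF f M.left_module_axioms N.left_module_axioms])
  have add: "f x \<oplus>\<^bsub>N\<^esub> f y \<in> f ` carrier M" if "x \<in> carrier M" "y \<in> carrier M" for x y
    by (rule image_eqI[of _ _ "x \<oplus>\<^bsub>M\<^esub> y"]) (simp_all add: that mod_homD(2)[OF f])
  have smult: "r \<odot>\<^bsub>N\<^esub> f x \<in> f ` carrier M" if "r \<in> carrier L" "x \<in> carrier M" for r x
    by (rule image_eqI[of _ _ "r \<odot>\<^bsub>M\<^esub> x"])
      (simp_all add: that mod_homD(3)[OF f] M.lm_smult_closed)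
  have zero: "\<zero>\<^bsub>N\<^esub> \<in> f ` carrier M"
    using imageI[OF M.M.zero_closed, of f] by (simp only: f0)
  have "abelian_group (image_module f M N)"
  proof (rule abelian_groupI)
    show "\<exists>y\<in>carrier (image_module f M N). y \<oplus>\<^bsub>image_module f M N\<^esub> x = \<zero>\<^bsub>image_module f M N\<^esub>"
      if "x \<in> carrier (image_module f M N)" for x
    proof -
      have "x \<in> f ` carrier M" using that by (simp only: image_module_simps)
      then obtain a where a: "x = f a" "a \<in> carrier M" by (rule imageE)
      have "f (\<ominus>\<^bsub>M\<^esub> a) \<oplus>\<^bsub>N\<^esub> f a = \<zero>\<^bsub>N\<^esub>"
        using a(2) mod_homD(2)[OF f, of "\<ominus>\<^bsub>M\<^esub> a" a] by (simp add: f0 M.M.l_neg)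
      then show ?thesis
        by (intro bexI[of _ "f (\<ominus>\<^bsub>M\<^esub> a)"]) (simp_all add: a)
    qed
  qed (auto simp: add zero mod_homD(1)[OF f] N.M.a_ac)
  then have "left_module L (image_module f M N)"
    by (intro left_module.intro left_module_axioms.intro M.ring_axioms)
      (auto simp: add smult mod_homD(1)[OF f] N.lm_smult_l_distr N.lm_smult_r_distr N.lm_smult_assoc
        N.lm_smult_one)
  then show ?thesis
    by (rule fg_module_transport[OF M mod_hom_image_module(1)[OF f], rotated]) simp
qed


section \<open>Universal properties for modules with arbitrary carrier types\<close>

lemma injective_extend:
  fixes L :: "('r, 'z) ring_scheme"
  assumes I: "injective L I" and M: "fg_module L M" and N: "fg_module L N"
    and f: "f \<in> mod_hom L M N" "inj_on f (carrier M)" and k: "k \<in> mod_hom L M I"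
  obtains t where "t \<in> mod_hom L N I" "\<And>x. x \<in> carrier M \<Longrightarrow> t (f x) = k x"
proof -
  note thesisI = that
  obtain M' :: "'r test_module" and \<phi> \<psi> where M': "fg_module L M'" "\<phi> \<in> mod_hom L M M'"
    "\<psi> \<in> mod_hom L M' M" "\<And>x. x \<in> carrier M \<Longrightarrow> \<psi> (\<phi> x) = x" "\<And>y. y \<in> carrier M' \<Longrightarrow> \<phi> (\<psi> y) = y"
    using fg_module_test_copy[OF M] by blast
  obtain N' :: "'r test_module" and \<phi>' \<psi>' where N': "fg_module L N'" "\<phi>' \<in> mod_hom L N N'"
    "\<psi>' \<in> mod_hom L N' N" "\<And>x. x \<in> carrier N \<Longrightarrow> \<psi>' (\<phi>' x) = x" "\<And>y. y \<in> carrier N' \<Longrightarrow> \<phi>' (\<psi>' y) = y"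
    using fg_module_test_copy[OF N] by blast
  have 1: "(\<lambda>x. \<phi>' (f (\<psi> x))) \<in> mod_hom L M' N'" "(\<lambda>x. k (\<psi> x)) \<in> mod_hom L M' I"
    by (rule mod_hom_comp[OF mod_hom_comp[OF M'(3) f(1)] N'(2)] mod_hom_comp[OF M'(3) k])+
  have "inj_on (\<lambda>x. \<phi>' (f (\<psi> x))) (carrier M')"
  proof (rule inj_onI)
    fix x y assume xy: "x \<in> carrier M'" "y \<in> carrier M'" "\<phi>' (f (\<psi> x)) = \<phi>' (f (\<psi> y))"
    have m: "\<psi> x \<in> carrier M" "\<psi> y \<in> carrier M"
      using xy mod_homD(1)[OF M'(3)] by auto
    then have "f (\<psi> x) = f (\<psi> y)"
      using xy(3) N'(4) mod_homD(1)[OF f(1)] by metis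
    then have "\<psi> x = \<psi> y"
      using m inj_onD[OF f(2)] by simp
    then show "x = y"
      using xy M'(5) by metis
  qed
  then obtain t where t: "t \<in> mod_hom L N' I" "\<forall>x\<in>carrier M'. t (\<phi>' (f (\<psi> x))) = k (\<psi> x)"
    using I 1 M'(1) N'(1) unfolding injective_def by blast
  show thesis
  proof (rule thesisI[OF mod_hom_comp[OF N'(2) t(1)]])
    show "t (\<phi>' (f x)) = k x" if "x \<in> carrier M" for x
      using t(2) M'(4)[OF that] mod_homD(1)[OF M'(2) that] by force
  qed
qed

lemma projective_testD:
  fixes L :: "('r, 'z) ring_scheme" and M N :: "'r test_module"
  assumes "projective L P" "fg_module L M" "fg_module L N" "g \<in> mod_hom L M N"
    "g ` carrier M = carrier N" "k \<in> mod_hom L P N"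
  shows "\<exists>t\<in>mod_hom L P M. \<forall>x\<in>carrier P. g (t x) = k x"
  using assms by (simp add: projective_def)

lemma projective_lift:
  fixes L :: "('r, 'z) ring_scheme"
  assumes P: "projective L P" and M: "fg_module L M" and N: "fg_module L N"
    and q: "q \<in> mod_hom L M N" "q ` carrier M = carrier N" and k: "k \<in> mod_hom L P N"
  obtains t where "t \<in> mod_hom L P M" "\<And>x. x \<in> carrier P \<Longrightarrow> q (t x) = k x"
proof -
  obtain M' :: "'r test_module" and \<phi> \<psi> where M': "fg_module L M'" "\<phi> \<in> mod_hom L M M'"
    "\<psi> \<in> mod_hom L M' M" "\<And>x. x \<in> carrier M \<Longrightarrow> \<psi> (\<phi> x) = x" "\<And>y. y \<in> carrier M' \<Longrightarrow> \<phi> (\<psi> y) = y"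
    using fg_module_test_copy[OF M] by blast
  obtain N' :: "'r test_module" and \<phi>' \<psi>' where N': "fg_module L N'" "\<phi>' \<in> mod_hom L N N'"
    "\<psi>' \<in> mod_hom L N' N" "\<And>x. x \<in> carrier N \<Longrightarrow> \<psi>' (\<phi>' x) = x" "\<And>y. y \<in> carrier N' \<Longrightarrow> \<phi>' (\<psi>' y) = y"
    using fg_module_test_copy[OF N] by blast
  have 1: "(\<lambda>x. \<phi>' (q (\<psi> x))) \<in> mod_hom L M' N'" "(\<lambda>x. \<phi>' (k x)) \<in> mod_hom L P N'"
    by (rule mod_hom_comp[OF mod_hom_comp[OF M'(3) q(1)] N'(2)] mod_hom_comp[OF k N'(2)])+
  have "\<exists>x\<in>carrier M'. \<phi>' (q (\<psi> x)) = y" if y: "y \<in> carrier N'" for y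
  proof -
    obtain m where "m \<in> carrier M" "q m = \<psi>' y"
      using q(2) mod_homD(1)[OF N'(3) y] by (metis imageE)
    then show ?thesis
      using M'(2,4) N'(5)[OF y] by (intro bexI[of _ "\<phi> m"]) (simp_all add: mod_homD)
  qed
  then have surj: "(\<lambda>x. \<phi>' (q (\<psi> x))) ` carrier M' = carrier N'"
    using mod_homD(1)[OF 1(1)] by blast
  have "\<exists>t\<in>mod_hom L P M'. \<forall>x\<in>carrier P. \<phi>' (q (\<psi> (t x))) = \<phi>' (k x)"
    by (rule projective_testD[OF P M'(1) N'(1) 1(1) surj 1(2)])
  then obtain t where t: "t \<in> mod_hom L P M'" "\<forall>x\<in>carrier P. \<phi>' (q (\<psi> (t x))) = \<phi>' (k x)"
    by (rule bexE)
  have "q (\<psi> (t x)) = k x" if x: "x \<in> carrier P" for x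
  proof -
    have "\<psi>' (\<phi>' (q (\<psi> (t x)))) = \<psi>' (\<phi>' (k x))"
      using t(2) x by simp
    then show ?thesis
      using N'(4)[OF mod_homD(1)[OF k x]]
        N'(4)[OF mod_homD(1)[OF q(1) mod_homD(1)[OF M'(3) mod_homD(1)[OF t(1) x]]]] by simp
  qed
  then show thesis
    by (rule that[OF mod_hom_comp[OF t(1) M'(3)]])
qed

text \<open>The negated splitting in the definition becomes the second case of an elimination rule;
  \<open>right_lift\<close> branches on the two outcomes.\<close>

lemma right_almost_split_lift:
  fixes L :: "('r, 'z) ring_scheme"
  assumes g: "right_almost_split L B g A" and M: "fg_module L M" and k: "k \<in> mod_hom L M A"
  obtains t where "t \<in> mod_hom L M B" "\<And>x. x \<in> carrier M \<Longrightarrow> g (t x) = k x"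
    | t where "t \<in> mod_hom L A M" "\<And>x. x \<in> carrier A \<Longrightarrow> k (t x) = x"
proof -
  obtain M' :: "'r test_module" and \<phi> \<psi> where M': "fg_module L M'" "\<phi> \<in> mod_hom L M M'"
    "\<psi> \<in> mod_hom L M' M" "\<And>x. x \<in> carrier M \<Longrightarrow> \<psi> (\<phi> x) = x" "\<And>y. y \<in> carrier M' \<Longrightarrow> \<phi> (\<psi> y) = y"
    using fg_module_test_copy[OF M] by blast
  have k': "(\<lambda>x. k (\<psi> x)) \<in> mod_hom L M' A"
    by (rule mod_hom_comp[OF M'(3) k])
  show thesis
  proof (cases "split_epi L M' (\<lambda>x. k (\<psi> x)) A")
    case True
    then obtain t where "t \<in> mod_hom L A M'" "\<forall>x\<in>carrier A. k (\<psi> (t x)) = x"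
      by (auto simp: split_epi_def)
    then show thesis
      using that(2)[OF mod_hom_comp[OF _ M'(3)]] by force
  next
    case False
    then obtain t where t: "t \<in> mod_hom L M' B" "\<forall>x\<in>carrier M'. g (t x) = k (\<psi> x)"
      using g M'(1) k' unfolding right_almost_split_def by blast
    then show thesis
      using that(1)[OF mod_hom_comp[OF M'(2) t(1)]] M'(4) mod_homD(1)[OF M'(2)] by simp
  qed
qed

lemma left_almost_split_extend:
  fixes L :: "('r, 'z) ring_scheme"
  assumes f: "left_almost_split L C f B" and M: "fg_module L M" and k: "k \<in> mod_hom L C M"
  obtains t where "t \<in> mod_hom L B M" "\<And>x. x \<in> carrier C \<Longrightarrow> t (f x) = k x"
    | t where "t \<in> mod_hom L M C" "\<And>x. x \<in> carrier C \<Longrightarrow> t (k x) = x"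
proof -
  obtain M' :: "'r test_module" and \<phi> \<psi> where M': "fg_module L M'" "\<phi> \<in> mod_hom L M M'"
    "\<psi> \<in> mod_hom L M' M" "\<And>x. x \<in> carrier M \<Longrightarrow> \<psi> (\<phi> x) = x" "\<And>y. y \<in> carrier M' \<Longrightarrow> \<phi> (\<psi> y) = y"
    using fg_module_test_copy[OF M] by blast
  have k': "(\<lambda>x. \<phi> (k x)) \<in> mod_hom L C M'"
    by (rule mod_hom_comp[OF k M'(2)])
  show thesis
  proof (cases "split_mono L C (\<lambda>x. \<phi> (k x)) M'")
    case True
    then obtain t where "t \<in> mod_hom L M' C" "\<forall>x\<in>carrier C. t (\<phi> (k x)) = x"
      by (auto simp: split_mono_def)
    then show thesis
      using that(2)[OF mod_hom_comp[OF M'(2)]] by force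
  next
    case False
    then obtain t where t: "t \<in> mod_hom L B M'" "\<forall>x\<in>carrier C. t (f x) = \<phi> (k x)"
      using f M'(1) k' unfolding left_almost_split_def by blast
    then show thesis
      using that(1)[OF mod_hom_comp[OF t(1) M'(3)]] M'(4) mod_homD(1)[OF k] by simp
  qed
qed


section \<open>Short exact sequences\<close>

lemma short_exactD:
  assumes "short_exact L C f B g A"
  shows "left_module L C" "left_module L B" "left_module L A"
    and "f \<in> mod_hom L C B" "g \<in> mod_hom L B A" "inj_on f (carrier C)" "g ` carrier B = carrier A"
    and "\<And>c. c \<in> carrier C \<Longrightarrow> g (f c) = \<zero>\<^bsub>A\<^esub>"
    and "\<And>b. \<lbrakk>b \<in> carrier B; g b = \<zero>\<^bsub>A\<^esub>\<rbrakk> \<Longrightarrow> \<exists>c\<in>carrier C. b = f c"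
proof -
  have kernel: "f ` carrier C = {b \<in> carrier B. g b = \<zero>\<^bsub>A\<^esub>}"
    using assms by (simp add: short_exact_def)
  show "g (f c) = \<zero>\<^bsub>A\<^esub>" if "c \<in> carrier C" for c
    using imageI[OF that, of f] unfolding kernel by simp
  show "\<exists>c\<in>carrier C. b = f c" if "b \<in> carrier B" "g b = \<zero>\<^bsub>A\<^esub>" for b
  proof -
    have "b \<in> f ` carrier C" unfolding kernel using that by simp
    then show ?thesis by (rule imageE) (rule bexI)
  qed
qed (use assms in \<open>simp_all add: short_exact_def fg_module_def\<close>)

text \<open>The difference of \<open>b\<close> and \<open>b'\<close> lies in the kernel of
  \<open>g\<close>, hence in the image of \<open>f\<close>. The diagram chases below use this to
  correct an element inside its fibre.\<close>

lemma short_exact_fibre: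
  assumes E: "short_exact L C f B g A" and b: "b \<in> carrier B" "b' \<in> carrier B" "g b = g b'"
  obtains c where "c \<in> carrier C" "b = b' \<oplus>\<^bsub>B\<^esub> f c"
proof -
  note E' = short_exactD[OF E]
  interpret B: left_module L B by (rule E'(2))
  interpret A: left_module L A by (rule E'(3))
  have "g (b \<ominus>\<^bsub>B\<^esub> b') = \<zero>\<^bsub>A\<^esub>"
    by (rule mod_hom_diff_eq_zero[OF E'(5) E'(2,3) b])
  then obtain c where c: "c \<in> carrier C" "b \<ominus>\<^bsub>B\<^esub> b' = f c"
    using E'(9)[of "b \<ominus>\<^bsub>B\<^esub> b'"] b by (auto simp: B.M.minus_closed)
  have "b = b' \<oplus>\<^bsub>B\<^esub> (b \<ominus>\<^bsub>B\<^esub> b')"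
    using b by (simp add: B.M.add_diff_cancel)
  then show thesis
    using that c by simp
qed

section \<open>Cartesian and cocartesian squares between exact rows\<close>

text \<open>The clause in \<open>pullback\<close> covers only test modules. Two exact rows with the
  same kernel \<open>C\<close> make the square cartesian by themselves: a preimage under
  \<open>l\<close> is corrected by an element of \<open>s C\<close>, and uniqueness holds because
  \<open>h s = f\<close> is injective.\<close>

lemma pullback_lift:
  assumes E: "short_exact L C f B g A" and E': "short_exact L C s Z l P"
    and h: "h \<in> mod_hom L Z B" and p: "p \<in> mod_hom L P A"
    and gh: "\<And>z. z \<in> carrier Z \<Longrightarrow> g (h z) = p (l z)"
    and hs: "\<And>c. c \<in> carrier C \<Longrightarrow> h (s c) = f c"
    and M: "left_module L M" and a: "a \<in> mod_hom L M B" and b: "b \<in> mod_hom L M P"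
    and ab: "\<And>x. x \<in> carrier M \<Longrightarrow> g (a x) = p (b x)"
  obtains t where "t \<in> mod_hom L M Z" "\<And>x. x \<in> carrier M \<Longrightarrow> h (t x) = a x"
    "\<And>x. x \<in> carrier M \<Longrightarrow> l (t x) = b x"
proof -
  note D = short_exactD[OF E] and D' = short_exactD[OF E']
  interpret C: left_module L C by (rule D(1))
  interpret Z: left_module L Z by (rule D'(2))
  interpret B: left_module L B by (rule D(2))
  interpret P: left_module L P by (rule D'(3))
  note [simp] = mod_homD[OF h] mod_homD[OF a] mod_homD[OF b] mod_homD[OF D'(4)] mod_homD[OF D'(5)]
    mod_homD[OF D(4)] D'(8) gh hs ab
  have total: "\<exists>z\<in>carrier Z. h z = a x \<and> l z = b x" if x: "x \<in> carrier M" for x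
  proof -
    have "b x \<in> l ` carrier Z" using x by (simp add: D'(7))
    then obtain z where z: "b x = l z" "z \<in> carrier Z" by (rule imageE)
    have "g (a x) = g (h z)" using x z by (metis ab gh)
    then obtain c where c: "c \<in> carrier C" "a x = h z \<oplus>\<^bsub>B\<^esub> f c"
      using short_exact_fibre[OF E, of "a x" "h z"] x z by auto
    \<comment> \<open>\<open>z\<close> already lies over \<open>b x\<close>, while
      \<open>h z\<close> misses \<open>a x\<close> by \<open>f c = h (s c)\<close>; adding
      \<open>s c\<close> repairs this without changing \<open>l\<close>.\<close>
    show ?thesis
      by (rule bexI[of _ "z \<oplus>\<^bsub>Z\<^esub> s c"]) (use x z(2) c in \<open>simp_all add: z(1)\<close>)
  qed
  have single: "z = z'" if z: "z \<in> carrier Z" "z' \<in> carrier Z" "h z = h z'" "l z = l z'" for z z'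
  proof -
    obtain c where c: "c \<in> carrier C" "z = z' \<oplus>\<^bsub>Z\<^esub> s c"
      using short_exact_fibre[OF E' z(1,2,4)] by blast
    then have "h z' \<oplus>\<^bsub>B\<^esub> f c = h z'" using z by simp
    then have "f c = f \<zero>\<^bsub>C\<^esub>" using z c by (simp add: mod_hom_zero[OF D(4,1,2)])
    then have "c = \<zero>\<^bsub>C\<^esub>" using inj_onD[OF D(6)] c by simp
    then show ?thesis using c z by (simp add: mod_hom_zero[OF D'(4,1,2)])
  qed
  obtain t where "t \<in> mod_hom L M Z" "\<And>x. x \<in> carrier M \<Longrightarrow> h (t x) = a x \<and> l (t x) = b x"
  proof (rule mod_hom_of_graph[OF _ _ _ _ M D'(2), of "\<lambda>x z. h z = a x \<and> l z = b x"])
    show "\<exists>z\<in>carrier Z. h z = a x \<and> l z = b x" if "x \<in> carrier M" for x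
      by (rule total[OF that])
    show "y = z" if "y \<in> carrier Z" "z \<in> carrier Z" "h y = a x \<and> l y = b x" "h z = a x \<and> l z = b x"
      for x y z
      using that by (intro single) simp_all
  qed simp_all
  then show thesis using that by blast
qed

text \<open>Since \<open>v d = g\<close> is onto and the kernel of \<open>v\<close> is
  \<open>u I\<close>, each element of \<open>Y\<close> has the form \<open>u i + d x\<close>, and
  its value must be \<open>b i + a x\<close>. Two representations differ by some \<open>c\<close> in
  \<open>C\<close>, with \<open>x = x' + f c\<close> and \<open>i' = i + e c\<close>, and
  \<open>ab\<close> makes the two changes cancel.\<close>

lemma pushout_extend:
  assumes E: "short_exact L C f B g A" and E': "short_exact L I u Y v A"
    and d: "d \<in> mod_hom L B Y" and e: "e \<in> mod_hom L C I"
    and df: "\<And>c. c \<in> carrier C \<Longrightarrow> d (f c) = u (e c)"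
    and vd: "\<And>b. b \<in> carrier B \<Longrightarrow> v (d b) = g b"
    and N: "left_module L N" and a: "a \<in> mod_hom L B N" and b: "b \<in> mod_hom L I N"
    and ab: "\<And>c. c \<in> carrier C \<Longrightarrow> a (f c) = b (e c)"
  obtains t where "t \<in> mod_hom L Y N" "\<And>x. x \<in> carrier B \<Longrightarrow> t (d x) = a x"
    "\<And>i. i \<in> carrier I \<Longrightarrow> t (u i) = b i"
proof -
  note D = short_exactD[OF E] and D' = short_exactD[OF E']
  interpret C: left_module L C by (rule D(1))
  interpret B: left_module L B by (rule D(2))
  interpret A: left_module L A by (rule D(3))
  interpret I: left_module L I by (rule D'(1))
  interpret Y: left_module L Y by (rule D'(2))
  interpret N: left_module L N by (rule N)
  note [simp] = mod_homD[OF d] mod_homD[OF e] mod_homD[OF a] mod_homD[OF b] mod_homD[OF D'(4)]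
    mod_homD[OF D'(5)] mod_homD[OF D(4)] mod_homD[OF D(5)] D'(8) df vd ab
  let ?G = "\<lambda>y n. \<exists>i\<in>carrier I. \<exists>x\<in>carrier B. y = u i \<oplus>\<^bsub>Y\<^esub> d x \<and> n = b i \<oplus>\<^bsub>N\<^esub> a x"
  have total: "\<exists>n\<in>carrier N. ?G y n" if y: "y \<in> carrier Y" for y
  proof -
    have "v y \<in> g ` carrier B" using y by (simp add: D(7))
    then obtain x where x: "v y = g x" "x \<in> carrier B" by (rule imageE)
    then obtain i where i: "i \<in> carrier I" "y = d x \<oplus>\<^bsub>Y\<^esub> u i"
      using short_exact_fibre[OF E', of y "d x"] y by auto
    show ?thesis
    proof (intro bexI conjI)
      show "y = u i \<oplus>\<^bsub>Y\<^esub> d x" using i x by (simp add: Y.M.a_comm)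
      show "b i \<oplus>\<^bsub>N\<^esub> a x \<in> carrier N" using i(1) x(2) by simp
    qed (use i x in simp_all)
  qed
  have single: "b i \<oplus>\<^bsub>N\<^esub> a x = b i' \<oplus>\<^bsub>N\<^esub> a x'"
    if i: "i \<in> carrier I" "i' \<in> carrier I" and x: "x \<in> carrier B" "x' \<in> carrier B"
      and eq: "u i \<oplus>\<^bsub>Y\<^esub> d x = u i' \<oplus>\<^bsub>Y\<^esub> d x'" for i i' x x'
  proof -
    have "v (u i \<oplus>\<^bsub>Y\<^esub> d x) = v (u i' \<oplus>\<^bsub>Y\<^esub> d x')" using eq by simp
    then have "g x = g x'" using i x by simp
    then obtain c where c: "c \<in> carrier C" "x = x' \<oplus>\<^bsub>B\<^esub> f c"
      using short_exact_fibre[OF E x] by blast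
    \<comment> \<open>As \<open>d f = u e\<close>, the discrepancy \<open>c\<close> moves from the
      \<open>B\<close> summand to the \<open>I\<close> summand, where injectivity of
      \<open>u\<close> can compare the two representations.\<close>
    have "u (i \<oplus>\<^bsub>I\<^esub> e c) \<oplus>\<^bsub>Y\<^esub> d x' = u i' \<oplus>\<^bsub>Y\<^esub> d x'"
      using eq i x c by (simp add: Y.M.a_ac)
    then have "u (i \<oplus>\<^bsub>I\<^esub> e c) = u i'"
      using i x c by (simp del: mod_homD(2)[OF D'(4)])
    then have "i' = i \<oplus>\<^bsub>I\<^esub> e c"
      using inj_onD[OF D'(6)] i c by (metis I.M.a_closed mod_homD(1)[OF e])
    then show ?thesis using i x c by (simp add: N.M.a_ac)
  qed
  obtain t where t: "t \<in> mod_hom L Y N" "\<And>y n. \<lbrakk>y \<in> carrier Y; n \<in> carrier N; ?G y n\<rbrakk> \<Longrightarrow> t y = n"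
  proof (rule mod_hom_of_graph[OF _ _ _ _ D'(2) N, of ?G])
    note thesisI = that
    show "\<exists>n\<in>carrier N. ?G y n" if "y \<in> carrier Y" for y
      by (rule total[OF that])
    show "n = n'" if G: "?G y n" "?G y n'" for y n n'
    proof -
      from G obtain i x i' x' where "i \<in> carrier I" "x \<in> carrier B" "y = u i \<oplus>\<^bsub>Y\<^esub> d x"
        "n = b i \<oplus>\<^bsub>N\<^esub> a x" "i' \<in> carrier I" "x' \<in> carrier B" "y = u i' \<oplus>\<^bsub>Y\<^esub> d x'"
        "n' = b i' \<oplus>\<^bsub>N\<^esub> a x'" by blast
      then show ?thesis using single[of i i' x x'] by simp
    qed
    show "?G (y \<oplus>\<^bsub>Y\<^esub> y') (n \<oplus>\<^bsub>N\<^esub> n')" if G: "?G y n" "?G y' n'" for y n y' n'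
    proof -
      from G obtain i x i' x' where *: "i \<in> carrier I" "x \<in> carrier B" "y = u i \<oplus>\<^bsub>Y\<^esub> d x"
        "n = b i \<oplus>\<^bsub>N\<^esub> a x" "i' \<in> carrier I" "x' \<in> carrier B" "y' = u i' \<oplus>\<^bsub>Y\<^esub> d x'"
        "n' = b i' \<oplus>\<^bsub>N\<^esub> a x'" by blast
      show ?thesis
        by (rule bexI[of _ "i \<oplus>\<^bsub>I\<^esub> i'"], rule bexI[of _ "x \<oplus>\<^bsub>B\<^esub> x'"])
          (use * in \<open>simp_all add: N.M.a_ac Y.M.a_ac\<close>)
    qed
    show "?G (r \<odot>\<^bsub>Y\<^esub> y) (r \<odot>\<^bsub>N\<^esub> n)" if r: "r \<in> carrier L" and G: "?G y n" for r y n
    proof -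
      from G obtain i x where *: "i \<in> carrier I" "x \<in> carrier B" "y = u i \<oplus>\<^bsub>Y\<^esub> d x"
        "n = b i \<oplus>\<^bsub>N\<^esub> a x" by blast
      show ?thesis
        by (rule bexI[of _ "r \<odot>\<^bsub>I\<^esub> i"], rule bexI[of _ "r \<odot>\<^bsub>B\<^esub> x"])
          (use * r in \<open>simp_all add: N.lm_smult_r_distr Y.lm_smult_r_distr I.lm_smult_closed
            B.lm_smult_closed\<close>)
    qed
    show thesis if "w \<in> mod_hom L Y N"
      "\<And>y n. \<lbrakk>y \<in> carrier Y; n \<in> carrier N; ?G y n\<rbrakk> \<Longrightarrow> w y = n" for w
      by (rule thesisI[OF that])
  qed
  show thesis
  proof (rule that[OF t(1)])
    show "t (d x) = a x" if x: "x \<in> carrier B" for x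
    proof (rule t(2))
      show "?G (d x) (a x)"
        by (rule bexI[of _ "\<zero>\<^bsub>I\<^esub>"], rule bexI[of _ x])
          (use x in \<open>simp_all add: mod_hom_zero[OF D'(4,1,2)] mod_hom_zero[OF b D'(1) N]\<close>)
    qed (use x in simp_all)
    show "t (u i) = b i" if i: "i \<in> carrier I" for i
    proof (rule t(2))
      show "?G (u i) (b i)"
        by (rule bexI[of _ i], rule bexI[of _ "\<zero>\<^bsub>B\<^esub>"])
          (use i in \<open>simp_all add: mod_hom_zero[OF d D(2) D'(2)] mod_hom_zero[OF a D(2) N]\<close>)
    qed (use i in simp_all)
  qed
qed

section \<open>Extensions with an injective or a projective end\<close>

text \<open>Injectivity of \<open>I\<close> gives a retraction \<open>\<rho>\<close> of
  \<open>u\<close>, so that \<open>\<rho>\<close> and \<open>v\<close> are coordinates identifying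
  \<open>Y\<close> with the sum of \<open>I\<close> and \<open>A\<close>. The second coordinate of
  \<open>t\<close> is prescribed as \<open>k\<close>; the first extends \<open>\<rho> a\<close> from
  \<open>K\<close> to \<open>N\<close>, again by injectivity. Then \<open>t j\<close> and
  \<open>a\<close> have equal coordinates.\<close>

lemma extend_to_injective_extension:
  assumes E: "short_exact L I u Y v A" and I: "injective L I"
    and K: "fg_module L K" and N: "fg_module L N"
    and j: "j \<in> mod_hom L K N" "inj_on j (carrier K)"
    and a: "a \<in> mod_hom L K Y" and k: "k \<in> mod_hom L N A"
    and va: "\<And>x. x \<in> carrier K \<Longrightarrow> v (a x) = k (j x)"
  obtains t where "t \<in> mod_hom L N Y" "\<And>x. x \<in> carrier K \<Longrightarrow> t (j x) = a x"
    "\<And>x. x \<in> carrier N \<Longrightarrow> v (t x) = k x"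
proof -
  note D = short_exactD[OF E]
  interpret I: left_module L I by (rule D(1))
  interpret Y: left_module L Y by (rule D(2))
  have fgm: "fg_module L I" "fg_module L Y" using E by (simp_all add: short_exact_def)
  obtain \<rho> where \<rho>: "\<rho> \<in> mod_hom L Y I" "\<And>i. i \<in> carrier I \<Longrightarrow> \<rho> (u i) = i"
    using injective_extend[OF I fgm D(4,6) mod_hom_id] by blast
  obtain b where b: "b \<in> mod_hom L N I" "\<And>x. x \<in> carrier K \<Longrightarrow> b (j x) = \<rho> (a x)"
    using injective_extend[OF I K N j mod_hom_comp[OF a \<rho>(1)]] by blast
  note [simp] = mod_homD[OF j(1)] mod_homD[OF a] mod_homD[OF b(1)] mod_homD[OF \<rho>(1)]
    mod_homD[OF D(4)] mod_homD[OF D(5)] mod_homD[OF k] D(8) \<rho>(2) b(2) va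
  have total: "\<exists>y\<in>carrier Y. \<rho> y = b n \<and> v y = k n" if n: "n \<in> carrier N" for n
  proof -
    interpret A: left_module L A by (rule D(3))
    have "k n \<in> v ` carrier Y" using n by (simp add: D(7))
    then obtain y where y: "k n = v y" "y \<in> carrier Y" by (rule imageE)
    \<comment> \<open>\<open>y\<close> has the right second coordinate; adding
      \<open>u (b n - \<rho> y)\<close> makes the first one \<open>b n\<close> and leaves
      \<open>v\<close> unchanged.\<close>
    show ?thesis
      by (rule bexI[of _ "y \<oplus>\<^bsub>Y\<^esub> u (b n \<ominus>\<^bsub>I\<^esub> \<rho> y)"])
        (use n y(2) in \<open>simp_all add: y(1) I.M.add_diff_cancel\<close>)
  qed
  have single: "y = y'" if y: "y \<in> carrier Y" "y' \<in> carrier Y" "\<rho> y = \<rho> y'" "v y = v y'" for y y'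
  proof -
    obtain i where i: "i \<in> carrier I" "y = y' \<oplus>\<^bsub>Y\<^esub> u i"
      using short_exact_fibre[OF E y(1,2,4)] by blast
    then have "\<rho> y' \<oplus>\<^bsub>I\<^esub> i = \<rho> y'" using y by simp
    then have "i = \<zero>\<^bsub>I\<^esub>" using y i by simp
    then show ?thesis using i y by (simp add: mod_hom_zero[OF D(4,1,2)])
  qed
  obtain t where t: "t \<in> mod_hom L N Y" "\<And>n. n \<in> carrier N \<Longrightarrow> \<rho> (t n) = b n \<and> v (t n) = k n"
  proof (rule mod_hom_of_graph[OF _ _ _ _ fg_left_module[OF N] D(2),
        of "\<lambda>n y. \<rho> y = b n \<and> v y = k n"])
    show "\<exists>y\<in>carrier Y. \<rho> y = b n \<and> v y = k n" if "n \<in> carrier N" for n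
      by (rule total[OF that])
    show "y = y'" if "y \<in> carrier Y" "y' \<in> carrier Y" "\<rho> y = b n \<and> v y = k n" "\<rho> y' = b n \<and> v y' = k n"
      for n y y'
      using that by (intro single) simp_all
  qed simp_all
  show thesis
  proof (rule that[OF t(1)])
    show "t (j x) = a x" if "x \<in> carrier K" for x
      using that t(2)[of "j x"] by (intro single) (simp_all add: mod_homD(1)[OF t(1)])
    show "v (t x) = k x" if "x \<in> carrier N" for x
      using t(2)[OF that] by simp
  qed
qed

text \<open>A section \<open>j\<close> of \<open>l\<close> decomposes \<open>Z\<close> into
  \<open>s C\<close> and \<open>j P\<close>. On \<open>s C\<close> the lift has to be
  \<open>k\<close>, which lifts \<open>a s\<close> by \<open>qk\<close>; on \<open>j P\<close> any
  lift \<open>b\<close> of \<open>a j\<close> through \<open>q\<close> will do.\<close>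

lemma lift_from_extension_of_projective:
  assumes E: "short_exact L C s Z l P" and P: "projective L P"
    and M: "fg_module L M" and K: "fg_module L K"
    and q: "q \<in> mod_hom L M K" "q ` carrier M = carrier K"
    and a: "a \<in> mod_hom L Z K" and k: "k \<in> mod_hom L C M"
    and qk: "\<And>c. c \<in> carrier C \<Longrightarrow> q (k c) = a (s c)"
  obtains t where "t \<in> mod_hom L Z M" "\<And>z. z \<in> carrier Z \<Longrightarrow> q (t z) = a z"
    "\<And>c. c \<in> carrier C \<Longrightarrow> t (s c) = k c"
proof -
  note D = short_exactD[OF E]
  interpret C: left_module L C by (rule D(1))
  interpret Z: left_module L Z by (rule D(2))
  interpret P: left_module L P by (rule D(3))
  interpret M: left_module L M by (rule fg_left_module[OF M])
  have fgm: "fg_module L Z" "fg_module L P" using E by (simp_all add: short_exact_def)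
  obtain j where j: "j \<in> mod_hom L P Z" "\<And>x. x \<in> carrier P \<Longrightarrow> l (j x) = x"
    using projective_lift[OF P fgm D(5,7) mod_hom_id] by blast
  obtain b where b: "b \<in> mod_hom L P M" "\<And>x. x \<in> carrier P \<Longrightarrow> q (b x) = a (j x)"
    using projective_lift[OF P M K q mod_hom_comp[OF j(1) a]] by blast
  note [simp] = mod_homD[OF q(1)] mod_homD[OF a] mod_homD[OF b(1)] mod_homD[OF j(1)]
    mod_homD[OF D(4)] mod_homD[OF D(5)] mod_homD[OF k] D(8) j(2) b(2) qk
  let ?G = "\<lambda>z m. \<exists>c\<in>carrier C. \<exists>x\<in>carrier P. z = s c \<oplus>\<^bsub>Z\<^esub> j x \<and> m = k c \<oplus>\<^bsub>M\<^esub> b x"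
  have total: "\<exists>m\<in>carrier M. ?G z m" if z: "z \<in> carrier Z" for z
  proof -
    obtain c where c: "c \<in> carrier C" "z = j (l z) \<oplus>\<^bsub>Z\<^esub> s c"
      using short_exact_fibre[OF E, of z "j (l z)"] z by auto
    have "z = s c \<oplus>\<^bsub>Z\<^esub> j (l z)"
      using c z by (simp add: Z.M.a_comm)
    then show ?thesis
      using c(1) z
      by (intro bexI[of _ "k c \<oplus>\<^bsub>M\<^esub> b (l z)"] bexI[of _ c] bexI[of _ "l z"] conjI refl) simp_all
  qed
  have single: "c = c' \<and> x = x'"
    if c: "c \<in> carrier C" "c' \<in> carrier C" and x: "x \<in> carrier P" "x' \<in> carrier P"
      and eq: "s c \<oplus>\<^bsub>Z\<^esub> j x = s c' \<oplus>\<^bsub>Z\<^esub> j x'" for c c' x x'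
  proof -
    have "l (s c \<oplus>\<^bsub>Z\<^esub> j x) = l (s c' \<oplus>\<^bsub>Z\<^esub> j x')" using eq by simp
    then have "x = x'" using c x by simp
    then have "s c = s c'" using eq c x by simp
    then show ?thesis using inj_onD[OF D(6)] c \<open>x = x'\<close> by simp
  qed
  obtain t where t: "t \<in> mod_hom L Z M" "\<And>z. z \<in> carrier Z \<Longrightarrow> ?G z (t z)"
    "\<And>z m. \<lbrakk>z \<in> carrier Z; m \<in> carrier M; ?G z m\<rbrakk> \<Longrightarrow> t z = m"
  proof (rule mod_hom_of_graph[OF _ _ _ _ D(2) M.left_module_axioms, of ?G])
    note thesisI = that
    show "\<exists>m\<in>carrier M. ?G z m" if "z \<in> carrier Z" for z
      by (rule total[OF that])
    show "m = m'" if G: "?G z m" "?G z m'" for z m m'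
    proof -
      from G obtain c x c' x' where "c \<in> carrier C" "x \<in> carrier P" "z = s c \<oplus>\<^bsub>Z\<^esub> j x"
        "m = k c \<oplus>\<^bsub>M\<^esub> b x" "c' \<in> carrier C" "x' \<in> carrier P" "z = s c' \<oplus>\<^bsub>Z\<^esub> j x'"
        "m' = k c' \<oplus>\<^bsub>M\<^esub> b x'" by blast
      then show ?thesis using single[of c c' x x'] by simp
    qed
    show "?G (z \<oplus>\<^bsub>Z\<^esub> z') (m \<oplus>\<^bsub>M\<^esub> m')" if G: "?G z m" "?G z' m'" for z m z' m'
    proof -
      from G obtain c x c' x' where *: "c \<in> carrier C" "x \<in> carrier P" "z = s c \<oplus>\<^bsub>Z\<^esub> j x"
        "m = k c \<oplus>\<^bsub>M\<^esub> b x" "c' \<in> carrier C" "x' \<in> carrier P" "z' = s c' \<oplus>\<^bsub>Z\<^esub> j x'"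
        "m' = k c' \<oplus>\<^bsub>M\<^esub> b x'" by blast
      show ?thesis
        by (rule bexI[of _ "c \<oplus>\<^bsub>C\<^esub> c'"], rule bexI[of _ "x \<oplus>\<^bsub>P\<^esub> x'"])
          (use * in \<open>simp_all add: M.M.a_ac Z.M.a_ac\<close>)
    qed
    show "?G (r \<odot>\<^bsub>Z\<^esub> z) (r \<odot>\<^bsub>M\<^esub> m)" if r: "r \<in> carrier L" and G: "?G z m" for r z m
    proof -
      from G obtain c x where *: "c \<in> carrier C" "x \<in> carrier P" "z = s c \<oplus>\<^bsub>Z\<^esub> j x"
        "m = k c \<oplus>\<^bsub>M\<^esub> b x" by blast
      show ?thesis
        by (rule bexI[of _ "r \<odot>\<^bsub>C\<^esub> c"], rule bexI[of _ "r \<odot>\<^bsub>P\<^esub> x"])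
          (use * r in \<open>simp_all add: M.lm_smult_r_distr Z.lm_smult_r_distr C.lm_smult_closed
            P.lm_smult_closed\<close>)
    qed
    show thesis if "w \<in> mod_hom L Z M" "\<And>z. z \<in> carrier Z \<Longrightarrow> ?G z (w z)"
      "\<And>z m. \<lbrakk>z \<in> carrier Z; m \<in> carrier M; ?G z m\<rbrakk> \<Longrightarrow> w z = m" for w
      by (rule thesisI[OF that])
  qed
  show thesis
  proof (rule that[OF t(1)])
    show "q (t z) = a z" if z: "z \<in> carrier Z" for z
    proof -
      obtain c x where "c \<in> carrier C" "x \<in> carrier P" "z = s c \<oplus>\<^bsub>Z\<^esub> j x" "t z = k c \<oplus>\<^bsub>M\<^esub> b x"
        using t(2)[OF z] by blast
      then show ?thesis by simp
    qed
    show "t (s c) = k c" if c: "c \<in> carrier C" for c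
    proof (rule t(3))
      show "?G (s c) (k c)"
        by (rule bexI[of _ c], rule bexI[of _ "\<zero>\<^bsub>P\<^esub>"])
          (use c in \<open>simp_all add: mod_hom_zero[OF j(1) D(3,2)]
            mod_hom_zero[OF b(1) D(3) M.left_module_axioms]\<close>)
    qed (use c in simp_all)
  qed
qed

section \<open>Endomorphisms over a projective cover and under an injective envelope\<close>

lemma projective_cover_endo:
  assumes cover: "projective_cover L P p A" and A: "left_module L A"
    and \<alpha>: "\<alpha> \<in> mod_hom L P P" and p\<alpha>: "\<And>x. x \<in> carrier P \<Longrightarrow> p (\<alpha> x) = p x"
  obtains \<beta> where "\<beta> \<in> mod_hom L P P" "\<And>x. x \<in> carrier P \<Longrightarrow> \<alpha> (\<beta> x) = x"
    "\<And>x. x \<in> carrier P \<Longrightarrow> p (\<beta> x) = p x"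
proof -
  have P1: "projective L P"
    using cover by (simp add: projective_cover_def)
  then have P2: "fg_module L P"
    by (simp add: projective_def)
  have p: "p \<in> mod_hom L P A"
    and superfluous: "\<And>H. \<lbrakk>submodule H L P; H <+>\<^bsub>P\<^esub> {x \<in> carrier P. p x = \<zero>\<^bsub>A\<^esub>} = carrier P\<rbrakk>
      \<Longrightarrow> H = carrier P"
    using cover by (simp_all add: projective_cover_def)
  interpret P: left_module L P by (rule fg_left_module[OF P2])
  interpret A: left_module L A by (rule A)
  note [simp] = mod_homD[OF \<alpha>] mod_homD[OF p] p\<alpha>
  have "submodule (\<alpha> ` carrier P) L P"
  proof (rule P.lm_submoduleI)
    show "\<zero>\<^bsub>P\<^esub> \<in> \<alpha> ` carrier P"
      using imageI[OF P.M.zero_closed, of \<alpha>]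
      by (simp only: mod_hom_zero[OF \<alpha> P.left_module_axioms P.left_module_axioms])
    show "a \<oplus>\<^bsub>P\<^esub> b \<in> \<alpha> ` carrier P" if ab: "a \<in> \<alpha> ` carrier P" "b \<in> \<alpha> ` carrier P" for a b
    proof -
      obtain x where x: "a = \<alpha> x" "x \<in> carrier P" using ab(1) by (rule imageE)
      obtain y where y: "b = \<alpha> y" "y \<in> carrier P" using ab(2) by (rule imageE)
      show ?thesis
        by (rule image_eqI[of _ _ "x \<oplus>\<^bsub>P\<^esub> y"]) (simp_all add: x y)
    qed
    show "r \<odot>\<^bsub>P\<^esub> a \<in> \<alpha> ` carrier P" if r: "r \<in> carrier L" and a: "a \<in> \<alpha> ` carrier P" for r a
    proof -
      obtain x where x: "a = \<alpha> x" "x \<in> carrier P" using a by (rule imageE)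
      show ?thesis
        by (rule image_eqI[of _ _ "r \<odot>\<^bsub>P\<^esub> x"]) (simp_all add: x r P.lm_smult_closed)
    qed
  qed auto
  moreover have "\<alpha> ` carrier P <+>\<^bsub>P\<^esub> {x \<in> carrier P. p x = \<zero>\<^bsub>A\<^esub>} = carrier P"
  proof (rule equalityI)
    show "\<alpha> ` carrier P <+>\<^bsub>P\<^esub> {x \<in> carrier P. p x = \<zero>\<^bsub>A\<^esub>} \<subseteq> carrier P"
      by (auto simp: set_add_def')
    show "carrier P \<subseteq> \<alpha> ` carrier P <+>\<^bsub>P\<^esub> {x \<in> carrier P. p x = \<zero>\<^bsub>A\<^esub>}"
    proof
      fix x assume x: "x \<in> carrier P"
      have "x = \<alpha> x \<oplus>\<^bsub>P\<^esub> (x \<ominus>\<^bsub>P\<^esub> \<alpha> x)"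
        using x by (simp add: P.M.add_diff_cancel)
      moreover have "p (x \<ominus>\<^bsub>P\<^esub> \<alpha> x) = \<zero>\<^bsub>A\<^esub>"
        using x by (intro mod_hom_diff_eq_zero[OF p P.left_module_axioms A]) simp_all
      ultimately show "x \<in> \<alpha> ` carrier P <+>\<^bsub>P\<^esub> {x \<in> carrier P. p x = \<zero>\<^bsub>A\<^esub>}"
        using x unfolding set_add_def'
        by (intro UN_I[of "\<alpha> x"] imageI UN_I[of "x \<ominus>\<^bsub>P\<^esub> \<alpha> x"]) simp_all
    qed
  qed
  ultimately have surj: "\<alpha> ` carrier P = carrier P"
    by (rule superfluous)
  obtain \<beta> where \<beta>: "\<beta> \<in> mod_hom L P P" "\<And>x. x \<in> carrier P \<Longrightarrow> \<alpha> (\<beta> x) = x"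
    using projective_lift[OF P1 P2 P2 \<alpha> surj mod_hom_id] by blast
  show thesis
  proof (rule that[OF \<beta>])
    show "p (\<beta> x) = p x" if "x \<in> carrier P" for x
      using p\<alpha>[OF mod_homD(1)[OF \<beta>(1) that]] \<beta>(2)[OF that] by simp
  qed simp
qed

text \<open>\<open>\<alpha>\<close> fixes \<open>e C\<close>, so its kernel meets \<open>e C\<close>
  only in zero and vanishes because \<open>e C\<close> is essential. Extending the identity of
  \<open>I\<close> along the injection \<open>\<alpha>\<close> gives the left inverse.\<close>

lemma injective_envelope_endo:
  assumes envelope: "injective_envelope L C e I" and C: "left_module L C"
    and \<alpha>: "\<alpha> \<in> mod_hom L I I" and \<alpha>e: "\<And>c. c \<in> carrier C \<Longrightarrow> \<alpha> (e c) = e c"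
  obtains \<beta> where "\<beta> \<in> mod_hom L I I" "\<And>x. x \<in> carrier I \<Longrightarrow> \<beta> (\<alpha> x) = x"
    "\<And>c. c \<in> carrier C \<Longrightarrow> \<beta> (e c) = e c"
proof -
  have I: "injective L I" "fg_module L I" and e: "e \<in> mod_hom L C I"
    and essential: "\<And>H. \<lbrakk>submodule H L I; H \<inter> e ` carrier C = {\<zero>\<^bsub>I\<^esub>}\<rbrakk> \<Longrightarrow> H = {\<zero>\<^bsub>I\<^esub>}"
    using envelope by (simp_all add: injective_envelope_def injective_def)
  interpret I: left_module L I by (rule fg_left_module[OF I(2)])
  interpret C: left_module L C by (rule C)
  note [simp] = mod_homD[OF \<alpha>] mod_homD[OF e] \<alpha>e
  have \<alpha>0: "\<alpha> \<zero>\<^bsub>I\<^esub> = \<zero>\<^bsub>I\<^esub>"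
    by (rule mod_hom_zero[OF \<alpha> I.left_module_axioms I.left_module_axioms])
  have e0: "e \<zero>\<^bsub>C\<^esub> = \<zero>\<^bsub>I\<^esub>"
    by (rule mod_hom_zero[OF e C I.left_module_axioms])
  let ?K = "{x \<in> carrier I. \<alpha> x = \<zero>\<^bsub>I\<^esub>}"
  have "submodule ?K L I"
    by (rule I.lm_submoduleI) (auto simp: \<alpha>0 I.lm_smult_closed I.lm_smult_r_null)
  moreover have "?K \<inter> e ` carrier C = {\<zero>\<^bsub>I\<^esub>}"
  proof (intro equalityI subsetI)
    fix x assume "x \<in> ?K \<inter> e ` carrier C"
    then show "x \<in> {\<zero>\<^bsub>I\<^esub>}" by auto
  next
    fix x assume "x \<in> {\<zero>\<^bsub>I\<^esub>}"
    then show "x \<in> ?K \<inter> e ` carrier C"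
      using imageI[OF C.M.zero_closed, of e] by (simp add: \<alpha>0 e0)
  qed
  ultimately have kernel: "?K = {\<zero>\<^bsub>I\<^esub>}"
    by (rule essential)
  have inj: "inj_on \<alpha> (carrier I)"
  proof (rule inj_onI)
    fix x y assume xy: "x \<in> carrier I" "y \<in> carrier I" "\<alpha> x = \<alpha> y"
    then have "\<alpha> (x \<ominus>\<^bsub>I\<^esub> y) = \<zero>\<^bsub>I\<^esub>"
      by (intro mod_hom_diff_eq_zero[OF \<alpha> I.left_module_axioms I.left_module_axioms])
    then have "x \<ominus>\<^bsub>I\<^esub> y \<in> ?K" using xy by simp
    then have "x \<ominus>\<^bsub>I\<^esub> y = \<zero>\<^bsub>I\<^esub>" unfolding kernel by simp
    then show "x = y" by (rule I.M.eq_if_diff_eq_zero) (rule xy)+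
  qed
  obtain \<beta> where \<beta>: "\<beta> \<in> mod_hom L I I" "\<And>x. x \<in> carrier I \<Longrightarrow> \<beta> (\<alpha> x) = x"
    using injective_extend[OF I(1,2,2) \<alpha> inj mod_hom_id] by blast
  show thesis
  proof (rule that[OF \<beta>])
    show "\<beta> (e c) = e c" if "c \<in> carrier C" for c
      using \<beta>(2)[OF mod_homD(1)[OF e that]] \<alpha>e[OF that] by simp
  qed simp
qed


section \<open>The diagram of the pull-back and the push-out\<close>

locale almost_split_diagram =
  fixes L :: "('r, 'k) ring_scheme"
    and A :: "('r, 'a) module" and B :: "('r, 'b) module" and C :: "('r, 'c) module"
    and P :: "('r, 'p) module" and I :: "('r, 'i) module"
    and Z :: "('r, 'z) module" and Y :: "('r, 'y) module"
    and f :: "'c \<Rightarrow> 'b" and g :: "'b \<Rightarrow> 'a" and p :: "'p \<Rightarrow> 'a" and e :: "'c \<Rightarrow> 'i"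
    and s :: "'c \<Rightarrow> 'z" and l :: "'z \<Rightarrow> 'p" and h :: "'z \<Rightarrow> 'b"
    and u :: "'i \<Rightarrow> 'y" and v :: "'y \<Rightarrow> 'a" and d :: "'b \<Rightarrow> 'y"
  assumes seq: "almost_split_seq L C f B g A"
    and cover: "projective_cover L P p A"
    and envelope: "injective_envelope L C e I"
    and pullback: "pullback_seq L C f B g A P p s Z l h"
    and pushout: "pushout_seq L C f B g A I e u Y v d"
begin

lemma exact: "short_exact L C f B g A" "short_exact L C s Z l P" "short_exact L I u Y v A"
  using seq pullback pushout
  by (simp_all add: almost_split_seq_def pullback_seq_def pushout_seq_def)

lemma fg_modules: "fg_module L A" "fg_module L C" "fg_module L P" "fg_module L I" "fg_module L Z"
    "fg_module L Y" "fg_module L B"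
  using exact by (simp_all add: short_exact_def)

lemmas left_modules = fg_modules[THEN fg_left_module]
lemmas exact_B = short_exactD[OF exact(1)] and exact_Z = short_exactD[OF exact(2)]
  and exact_Y = short_exactD[OF exact(3)]

lemma projective_P: "projective L P" and cover_hom: "p \<in> mod_hom L P A" "p ` carrier P = carrier A"
  using cover by (simp_all add: projective_cover_def)

lemma injective_I: "injective L I" and envelope_hom: "e \<in> mod_hom L C I" "inj_on e (carrier C)"
  using envelope by (simp_all add: injective_envelope_def)

lemma pullback_hom: "h \<in> mod_hom L Z B" and gh: "z \<in> carrier Z \<Longrightarrow> g (h z) = p (l z)"
    and hs: "c \<in> carrier C \<Longrightarrow> h (s c) = f c"
  using pullback by (simp_all add: pullback_seq_def pullback_def)

lemma pushout_hom: "d \<in> mod_hom L B Y" and df: "c \<in> carrier C \<Longrightarrow> d (f c) = u (e c)"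
    and vd: "b \<in> carrier B \<Longrightarrow> v (d b) = g b"
  using pushout by (simp_all add: pushout_seq_def pushout_def)

text \<open>By \<open>v d = g\<close>, elements with the same image under \<open>d\<close> differ by
  some \<open>f c\<close>, and on those \<open>d f = u e\<close> is a composite of
  injections.\<close>

lemma d_inj: "inj_on d (carrier B)"
proof (rule inj_onI)
  interpret C: left_module L C by (rule left_modules)
  interpret B: left_module L B by (rule left_modules)
  interpret Y: left_module L Y by (rule left_modules)
  note [simp] = mod_homD[OF pushout_hom] mod_homD[OF exact_B(4)] mod_homD[OF exact_Y(4)] mod_homD[OF envelope_hom(1)] df
  fix b b' assume b: "b \<in> carrier B" "b' \<in> carrier B" "d b = d b'"
  then have "g b = g b'" by (metis vd)
  then obtain c where c: "c \<in> carrier C" "b = b' \<oplus>\<^bsub>B\<^esub> f c"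
    using short_exact_fibre[OF exact(1) b(1,2)] by blast
  then have "d b' \<oplus>\<^bsub>Y\<^esub> u (e c) = d b'" using b by simp
  then have "u (e c) = u \<zero>\<^bsub>I\<^esub>" using b c by (simp add: mod_hom_zero[OF exact_Y(4,1,2)])
  then have "e c = e \<zero>\<^bsub>C\<^esub>"
    using inj_onD[OF exact_Y(6), of "e c" "\<zero>\<^bsub>I\<^esub>"] c mod_hom_zero[OF envelope_hom(1) left_modules(2,4)]
      mod_homD(1)[OF envelope_hom(1), of "\<zero>\<^bsub>C\<^esub>"] by simp
  then have "c = \<zero>\<^bsub>C\<^esub>" using inj_onD[OF envelope_hom(2), of c "\<zero>\<^bsub>C\<^esub>"] c by simp
  then show "b = b'" using c b by (simp add: mod_hom_zero[OF exact_B(4,1,2)])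
qed

text \<open>Dual to \<open>d_inj\<close>: surjectivity of \<open>p\<close> and \<open>l\<close>
  gives some \<open>z\<close> with \<open>g (h z) = g b\<close>, and the remaining error
  \<open>f c = h (s c)\<close> is in the image of \<open>h\<close>.\<close>

lemma h_surj: "h ` carrier Z = carrier B"
proof (intro equalityI subsetI)
  interpret Z: left_module L Z by (rule left_modules)
  note [simp] = mod_homD[OF pullback_hom] mod_homD[OF exact_B(5)] mod_homD[OF exact_Z(4)] hs
  fix b assume b: "b \<in> carrier B"
  then have "g b \<in> p ` carrier P" by (simp add: cover_hom(2))
  then obtain x where x: "g b = p x" "x \<in> carrier P" by (rule imageE)
  then have "x \<in> l ` carrier Z" by (simp add: exact_Z(7))
  then obtain z where z: "x = l z" "z \<in> carrier Z" by (rule imageE)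
  have "g b = g (h z)" using x z by (simp add: gh)
  then obtain c where c: "c \<in> carrier C" "b = h z \<oplus>\<^bsub>B\<^esub> f c"
    using short_exact_fibre[OF exact(1) b, of "h z"] z(2) by auto
  show "b \<in> h ` carrier Z"
    by (rule image_eqI[of _ _ "z \<oplus>\<^bsub>Z\<^esub> s c"]) (use z(2) c in simp_all)
qed (use mod_homD(1)[OF pullback_hom] in auto)

lemma not_split_epi:
  assumes t: "(t1, t2) \<in> mor_hom L (P, p, A) (Z, d \<circ> h, Y)"
    and lt: "\<And>x. x \<in> carrier P \<Longrightarrow> l (t1 x) = x"
  shows False
proof -
  have t1: "t1 \<in> mod_hom L P Z" and comm: "\<And>x. x \<in> carrier P \<Longrightarrow> d (h (t1 x)) = t2 (p x)"
    using t by simp_all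
  have compatible: "h (t1 x) = h (t1 y)" if "x \<in> carrier P" "y \<in> carrier P" "p x = p y" for x y
    using inj_onD[OF d_inj, of "h (t1 x)" "h (t1 y)"] that mod_homD(1)[OF pullback_hom] mod_homD(1)[OF t1]
    by (simp add: comm)
  obtain w where w: "w \<in> mod_hom L A B" "\<And>x. x \<in> carrier P \<Longrightarrow> w (p x) = h (t1 x)"
    using mod_hom_factor_surj[OF cover_hom mod_hom_comp[OF t1 pullback_hom] compatible left_modules(3,1,7)] by blast
  have "g (w a) = a" if "a \<in> carrier A" for a
  proof -
    have "a \<in> p ` carrier P" using that by (simp add: cover_hom(2))
    then obtain x where x: "a = p x" "x \<in> carrier P" by (rule imageE)
    \<comment> \<open>\<open>g w p = g h t1 = p l t1 = p\<close>.\<close>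
    show ?thesis using w(2)[OF x(2)] gh[OF mod_homD(1)[OF t1 x(2)]] lt[OF x(2)] by (simp add: x(1))
  qed
  then have "split_epi L B g A"
    using exact_B(5) w(1) by (auto simp: split_epi_def)
  then show False
    using seq by (simp add: almost_split_seq_def right_almost_split_def)
qed

text \<open>Since \<open>h\<close> is onto and \<open>e t1 = t2 d h\<close>, the map
  \<open>t2 d\<close> has its image in \<open>e C\<close> and so equals \<open>e w\<close> for some
  \<open>w\<close> from \<open>B\<close> to \<open>C\<close>. This \<open>w\<close> would be a
  retraction of \<open>f\<close>.\<close>

lemma not_split_mono:
  assumes t: "(t1, t2) \<in> mor_hom L (Z, d \<circ> h, Y) (C, e, I)"
    and tu: "\<And>i. i \<in> carrier I \<Longrightarrow> t2 (u i) = i"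
  shows False
proof -
  have t1: "t1 \<in> mod_hom L Z C" and t2: "t2 \<in> mod_hom L Y I"
    and comm: "\<And>z. z \<in> carrier Z \<Longrightarrow> e (t1 z) = t2 (d (h z))"
    using t by simp_all
  have image: "t2 (d b) \<in> e ` carrier C" if "b \<in> carrier B" for b
  proof -
    have "b \<in> h ` carrier Z" using that by (simp add: h_surj)
    then obtain z where z: "b = h z" "z \<in> carrier Z" by (rule imageE)
    have "e (t1 z) \<in> e ` carrier C"
      using mod_homD(1)[OF t1 z(2)] by (rule imageI)
    then show ?thesis using comm[OF z(2)] by (simp add: z(1))
  qed
  obtain w where w: "w \<in> mod_hom L B C" "\<And>b. b \<in> carrier B \<Longrightarrow> e (w b) = t2 (d b)"
    using mod_hom_lift_inj[OF envelope_hom mod_hom_comp[OF pushout_hom t2] image left_modules(7,2)] by blast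
  have "w (f c) = c" if c: "c \<in> carrier C" for c
  proof (rule inj_onD[OF envelope_hom(2) _ _ c])
    \<comment> \<open>\<open>e w f = t2 d f = t2 u e = e\<close>.\<close>
    show "e (w (f c)) = e c"
      using c by (simp add: w(2) df tu mod_homD(1)[OF exact_B(4)] mod_homD(1)[OF envelope_hom(1)])
    show "w (f c) \<in> carrier C"
      by (intro mod_homD(1)[OF w(1)] mod_homD(1)[OF exact_B(4)] c)
  qed
  then have "split_mono L C f B"
    using exact_B(4) w(1) by (auto simp: split_mono_def)
  then show False
    using seq by (simp add: almost_split_seq_def left_almost_split_def)
qed

section \<open>The two almost split properties for pairs of maps\<close>

text \<open>\<open>K\<close> mediates between \<open>M\<close> and \<open>N\<close>:
  \<open>m\<close> is onto \<open>K\<close>, which permits lifting to \<open>M\<close>, and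
  \<open>K\<close> is included in \<open>N\<close>, which permits extension to \<open>N\<close>. The
  alternative is decided by the behaviour of \<open>k2\<close> on \<open>K\<close>.\<close>

lemma right_lift:
  assumes ob: "mor_object L (M, m, N)" and k: "(k1, k2) \<in> mor_hom L (M, m, N) (P, p, A)"
  shows "(\<exists>t1 t2. (t1, t2) \<in> mor_hom L (M, m, N) (Z, d \<circ> h, Y) \<and>
      (\<forall>x\<in>carrier M. l (t1 x) = k1 x) \<and> (\<forall>x\<in>carrier N. v (t2 x) = k2 x)) \<or>
    (\<exists>t1 t2. (t1, t2) \<in> mor_hom L (P, p, A) (M, m, N) \<and>
      (\<forall>x\<in>carrier P. k1 (t1 x) = x) \<and> (\<forall>x\<in>carrier A. k2 (t2 x) = x))"
proof -
  have M: "fg_module L M" and N: "fg_module L N" and m: "m \<in> mod_hom L M N"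
    using ob by simp_all
  have k1: "k1 \<in> mod_hom L M P" and k2: "k2 \<in> mod_hom L N A"
    and comm: "\<And>x. x \<in> carrier M \<Longrightarrow> p (k1 x) = k2 (m x)"
    using k by simp_all
  define K where "K = image_module m M N"
  have K: "fg_module L K" and q: "m \<in> mod_hom L M K" "m ` carrier M = carrier K"
    and j: "(\<lambda>x. x) \<in> mod_hom L K N"
    using fg_image_module[OF M N m] mod_hom_image_module[OF m] by (simp_all add: K_def)
  have k2': "k2 \<in> mod_hom L K A"
    using mod_hom_comp[OF j k2] by simp
  have right: "right_almost_split L B g A"
    using seq by (simp add: almost_split_seq_def)
  show ?thesis
  proof (rule right_almost_split_lift[OF right K k2'])
    fix w assume w: "w \<in> mod_hom L K B" "\<And>x. x \<in> carrier K \<Longrightarrow> g (w x) = k2 x"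
    have mK: "m x \<in> carrier K" if "x \<in> carrier M" for x
      using mod_homD(1)[OF q(1) that] .
    have gw: "g (w (m x)) = p (k1 x)" if "x \<in> carrier M" for x
      using w(2)[OF mK[OF that]] comm[OF that] by simp
    obtain t1 where t1: "t1 \<in> mod_hom L M Z" "\<And>x. x \<in> carrier M \<Longrightarrow> h (t1 x) = w (m x)"
      "\<And>x. x \<in> carrier M \<Longrightarrow> l (t1 x) = k1 x"
      using pullback_lift[OF exact(1,2) pullback_hom cover_hom(1) gh hs fg_left_module[OF M]
          mod_hom_comp[OF q(1) w(1)] k1 gw] by blast
    have vdw: "v (d (w x)) = k2 x" if "x \<in> carrier K" for x
      using vd[OF mod_homD(1)[OF w(1) that]] w(2)[OF that] by simp
    \<comment> \<open>\<open>t2\<close> must agree with \<open>d w\<close> on \<open>K\<close>, to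
      match \<open>d h t1\<close> there, and also satisfy \<open>v t2 = k2\<close> on all of
      \<open>N\<close>; mere extension of \<open>d w\<close> would not control the latter.\<close>
    obtain t2 where t2: "t2 \<in> mod_hom L N Y" "\<And>x. x \<in> carrier K \<Longrightarrow> t2 x = d (w x)"
      "\<And>x. x \<in> carrier N \<Longrightarrow> v (t2 x) = k2 x"
      using extend_to_injective_extension[OF exact(3) injective_I K N j _ mod_hom_comp[OF w(1) pushout_hom] k2 vdw]
      by auto
    have "(t1, t2) \<in> mor_hom L (M, m, N) (Z, d \<circ> h, Y)"
      using t1(1) t2(1) by (simp add: t1(2) t2(2) mK)
    then show ?thesis using t1(3) t2(3) by blast
  next
    fix r assume r: "r \<in> mod_hom L A K" "\<And>x. x \<in> carrier A \<Longrightarrow> k2 (r x) = x"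
    have rN: "r \<in> mod_hom L A N"
      using mod_hom_comp[OF r(1) j] by simp
    \<comment> \<open>\<open>r p\<close> has its values in \<open>K\<close>, so projectivity of
      \<open>P\<close> lifts it through \<open>m\<close>. The lift splits \<open>k1\<close> only up
      to the endomorphism \<open>k1 r1\<close> of \<open>P\<close>, which lies over \<open>A\<close>
      and is inverted on the right by \<open>\<beta>\<close> below.\<close>
    obtain r1 where r1: "r1 \<in> mod_hom L P M" "\<And>x. x \<in> carrier P \<Longrightarrow> m (r1 x) = r (p x)"
      using projective_lift[OF projective_P M K q mod_hom_comp[OF cover_hom(1) r(1)]] by blast
    have pk: "p (k1 (r1 x)) = p x" if "x \<in> carrier P" for x
      using that by (simp add: comm mod_homD(1)[OF r1(1)] r1(2) r(2) mod_homD(1)[OF cover_hom(1)])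
    obtain \<beta> where \<beta>: "\<beta> \<in> mod_hom L P P" "\<And>x. x \<in> carrier P \<Longrightarrow> k1 (r1 (\<beta> x)) = x"
      "\<And>x. x \<in> carrier P \<Longrightarrow> p (\<beta> x) = p x"
      using projective_cover_endo[OF cover left_modules(1) mod_hom_comp[OF r1(1) k1] pk] by blast
    \<comment> \<open>\<open>m r1 \<beta> = r p \<beta> = r p\<close>, so the correction keeps the
      square commutative with \<open>r\<close> unchanged.\<close>
    have "((\<lambda>x. r1 (\<beta> x)), r) \<in> mor_hom L (P, p, A) (M, m, N)"
      using mod_hom_comp[OF \<beta>(1) r1(1)] rN by (simp add: r1(2) \<beta>(3) mod_homD(1)[OF \<beta>(1)])
    then show ?thesis using \<beta>(2) r(2) by blast
  qed
qed

text \<open>The almost split property of \<open>f\<close> is applied to \<open>m k1\<close> as a map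
  into \<open>K\<close>. An extension \<open>w\<close> is lifted to \<open>M\<close> on the
  \<open>Z\<close> side and glued with \<open>k2\<close> on the \<open>Y\<close> side; a retraction
  \<open>r\<close> already yields the component from \<open>M\<close> to \<open>C\<close>, and only
  the \<open>I\<close> component needs a correction.\<close>

lemma left_extend:
  assumes ob: "mor_object L (M, m, N)" and k: "(k1, k2) \<in> mor_hom L (C, e, I) (M, m, N)"
  shows "(\<exists>t1 t2. (t1, t2) \<in> mor_hom L (Z, d \<circ> h, Y) (M, m, N) \<and>
      (\<forall>c\<in>carrier C. t1 (s c) = k1 c) \<and> (\<forall>i\<in>carrier I. t2 (u i) = k2 i)) \<or>
    (\<exists>t1 t2. (t1, t2) \<in> mor_hom L (M, m, N) (C, e, I) \<and>
      (\<forall>c\<in>carrier C. t1 (k1 c) = c) \<and> (\<forall>i\<in>carrier I. t2 (k2 i) = i))"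
proof -
  have M: "fg_module L M" and N: "fg_module L N" and m: "m \<in> mod_hom L M N"
    using ob by simp_all
  have k1: "k1 \<in> mod_hom L C M" and k2: "k2 \<in> mod_hom L I N"
    and comm: "\<And>c. c \<in> carrier C \<Longrightarrow> m (k1 c) = k2 (e c)"
    using k by simp_all
  define K where "K = image_module m M N"
  have K: "fg_module L K" and q: "m \<in> mod_hom L M K" "m ` carrier M = carrier K"
    and j: "(\<lambda>x. x) \<in> mod_hom L K N"
    using fg_image_module[OF M N m] mod_hom_image_module[OF m] by (simp_all add: K_def)
  have left: "left_almost_split L C f B"
    using seq by (simp add: almost_split_seq_def)
  show ?thesis
  proof (rule left_almost_split_extend[OF left K mod_hom_comp[OF k1 q(1)]])
    fix w assume w: "w \<in> mod_hom L B K" "\<And>c. c \<in> carrier C \<Longrightarrow> w (f c) = m (k1 c)"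
    have wN: "w \<in> mod_hom L B N"
      using mod_hom_comp[OF w(1) j] by simp
    have wf: "w (f c) = k2 (e c)" if "c \<in> carrier C" for c
      using w(2)[OF that] comm[OF that] by simp
    obtain t2 where t2: "t2 \<in> mod_hom L Y N" "\<And>x. x \<in> carrier B \<Longrightarrow> t2 (d x) = w x"
      "\<And>i. i \<in> carrier I \<Longrightarrow> t2 (u i) = k2 i"
      using pushout_extend[OF exact(1,3) pushout_hom envelope_hom(1) df vd fg_left_module[OF N] wN k2 wf] by blast
    \<comment> \<open>\<open>w h\<close> has to be lifted through \<open>m\<close> with the values
      on \<open>s C\<close> fixed as \<open>k1\<close>. Only a complement of \<open>s C\<close> in
      \<open>Z\<close>, a copy of \<open>P\<close>, is known to be projective.\<close>
    have whs: "m (k1 c) = w (h (s c))" if "c \<in> carrier C" for c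
      using w(2)[OF that] hs[OF that] by simp
    obtain t1 where t1: "t1 \<in> mod_hom L Z M" "\<And>z. z \<in> carrier Z \<Longrightarrow> m (t1 z) = w (h z)"
      "\<And>c. c \<in> carrier C \<Longrightarrow> t1 (s c) = k1 c"
      using lift_from_extension_of_projective[OF exact(2) projective_P M K q
          mod_hom_comp[OF pullback_hom w(1)] k1 whs] by blast
    have "(t1, t2) \<in> mor_hom L (Z, d \<circ> h, Y) (M, m, N)"
      using t1(1) t2(1) by (simp add: t1(2) t2(2) mod_homD(1)[OF pullback_hom])
    then show ?thesis using t1(3) t2(3) by blast
  next
    fix r assume r: "r \<in> mod_hom L K C" "\<And>c. c \<in> carrier C \<Longrightarrow> r (m (k1 c)) = c"
    have mK: "m x \<in> carrier K" if "x \<in> carrier M" for x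
      using mod_homD(1)[OF q(1) that] .
    \<comment> \<open>\<open>e r\<close> extends from \<open>K\<close> to \<open>N\<close>. The
      composite \<open>r2 k2\<close> fixes \<open>e C\<close> but need not be the identity of
      \<open>I\<close>; its left inverse \<open>\<beta>\<close> supplies the correction.\<close>
    obtain r2 where r2: "r2 \<in> mod_hom L N I" "\<And>x. x \<in> carrier K \<Longrightarrow> r2 x = e (r x)"
      using injective_extend[OF injective_I K N j _ mod_hom_comp[OF r(1) envelope_hom(1)]] by auto
    have re: "r2 (k2 (e c)) = e c" if "c \<in> carrier C" for c
      using r2(2)[OF mK[OF mod_homD(1)[OF k1 that]]] r(2)[OF that] comm[OF that] by simp
    obtain \<beta> where \<beta>: "\<beta> \<in> mod_hom L I I" "\<And>x. x \<in> carrier I \<Longrightarrow> \<beta> (r2 (k2 x)) = x"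
      "\<And>c. c \<in> carrier C \<Longrightarrow> \<beta> (e c) = e c"
      using injective_envelope_endo[OF envelope left_modules(2) mod_hom_comp[OF k2 r2(1)] re] by blast
    \<comment> \<open>\<open>\<beta> r2 m = \<beta> e r m = e r m\<close>, because
      \<open>\<beta>\<close> fixes \<open>e C\<close>.\<close>
    have "((\<lambda>x. r (m x)), (\<lambda>x. \<beta> (r2 x))) \<in> mor_hom L (M, m, N) (C, e, I)"
      using mod_hom_comp[OF q(1) r(1)] mod_hom_comp[OF r2(1) \<beta>(1)]
      by (simp add: r2(2) \<beta>(3) mK mod_homD(1)[OF r(1)])
    then show ?thesis using \<beta>(2) r(2) by blast
  qed
qed

end


section \<open>Modules over triangular matrices\<close>

text \<open>Diagonal matrices recover the actions of \<open>L\<close> on the two coordinates, so the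
  slices of a submodule \<open>H\<close> along both axes are submodules over \<open>L\<close>. Each
  contains the corresponding generators, and sums of elements of the two axes exhaust the
  module.\<close>

lemma fg_tri_module:
  assumes ob: "mor_object L (A, f, B)"
  shows "fg_module (T2 L) (tri_module (A, f, B))"
proof -
  have fgA: "fg_module L A" and fgB: "fg_module L B" and f: "f \<in> mod_hom L A B"
    using ob by simp_all
  interpret A: left_module L A by (rule fg_left_module[OF fgA])
  interpret B: left_module L B by (rule fg_left_module[OF fgB])
  let ?T = "tri_module (A, f, B)"
  have T: "left_module (T2 L) ?T"
    by (rule tri_module_left_module[OF A.left_module_axioms B.left_module_axioms f])
  have f0: "f \<zero>\<^bsub>A\<^esub> = \<zero>\<^bsub>B\<^esub>"
    by (rule mod_hom_zero[OF f A.left_module_axioms B.left_module_axioms])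
  obtain SA where SA: "finite SA" "SA \<subseteq> carrier A"
    "\<And>H. \<lbrakk>submodule H L A; SA \<subseteq> H\<rbrakk> \<Longrightarrow> H = carrier A"
    using fgA unfolding fg_module_def fin_gen_def by blast
  obtain SB where SB: "finite SB" "SB \<subseteq> carrier B"
    "\<And>H. \<lbrakk>submodule H L B; SB \<subseteq> H\<rbrakk> \<Longrightarrow> H = carrier B"
    using fgB unfolding fg_module_def fin_gen_def by blast
  let ?S = "SB \<times> {\<zero>\<^bsub>A\<^esub>} \<union> {\<zero>\<^bsub>B\<^esub>} \<times> SA"
  have "H = carrier ?T" if H: "submodule H (T2 L) ?T" "?S \<subseteq> H" for H
  proof -
    interpret H: submodule H "T2 L" ?T by (rule H(1))
    have zero: "(\<zero>\<^bsub>B\<^esub>, \<zero>\<^bsub>A\<^esub>) \<in> H"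
      using H.one_closed by simp
    have add: "(b \<oplus>\<^bsub>B\<^esub> b', a \<oplus>\<^bsub>A\<^esub> a') \<in> H" if "(b, a) \<in> H" "(b', a') \<in> H" for b b' a a'
      using H.m_closed[OF that] by simp
    have smult: "(x \<odot>\<^bsub>B\<^esub> b \<oplus>\<^bsub>B\<^esub> y \<odot>\<^bsub>B\<^esub> f a, z \<odot>\<^bsub>A\<^esub> a) \<in> H"
      if "x \<in> carrier L" "y \<in> carrier L" "z \<in> carrier L" "(b, a) \<in> H" for x y z b a
      using H.smult_closed[of "(x, y, z)" "(b, a)"] that by simp
    have "submodule {b \<in> carrier B. (b, \<zero>\<^bsub>A\<^esub>) \<in> H} L B"
    proof (rule B.lm_submoduleI)
      show "b \<oplus>\<^bsub>B\<^esub> b' \<in> {b \<in> carrier B. (b, \<zero>\<^bsub>A\<^esub>) \<in> H}"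
        if "b \<in> {b \<in> carrier B. (b, \<zero>\<^bsub>A\<^esub>) \<in> H}" "b' \<in> {b \<in> carrier B. (b, \<zero>\<^bsub>A\<^esub>) \<in> H}" for b b'
        using that add[of b "\<zero>\<^bsub>A\<^esub>" b' "\<zero>\<^bsub>A\<^esub>"] by simp
      show "r \<odot>\<^bsub>B\<^esub> b \<in> {b \<in> carrier B. (b, \<zero>\<^bsub>A\<^esub>) \<in> H}"
        if "r \<in> carrier L" "b \<in> {b \<in> carrier B. (b, \<zero>\<^bsub>A\<^esub>) \<in> H}" for r b
        using that smult[of r "\<zero>\<^bsub>L\<^esub>" "\<zero>\<^bsub>L\<^esub>" b "\<zero>\<^bsub>A\<^esub>"]
        by (simp add: f0 B.lm_smult_closed B.lm_smult_l_null A.lm_smult_l_null)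
    qed (use zero in auto)
    then have HB: "{b \<in> carrier B. (b, \<zero>\<^bsub>A\<^esub>) \<in> H} = carrier B"
      by (rule SB(3)) (use SB(2) H(2) in auto)
    have "submodule {a \<in> carrier A. (\<zero>\<^bsub>B\<^esub>, a) \<in> H} L A"
    proof (rule A.lm_submoduleI)
      show "a \<oplus>\<^bsub>A\<^esub> a' \<in> {a \<in> carrier A. (\<zero>\<^bsub>B\<^esub>, a) \<in> H}"
        if "a \<in> {a \<in> carrier A. (\<zero>\<^bsub>B\<^esub>, a) \<in> H}" "a' \<in> {a \<in> carrier A. (\<zero>\<^bsub>B\<^esub>, a) \<in> H}" for a a'
        using that add[of "\<zero>\<^bsub>B\<^esub>" a "\<zero>\<^bsub>B\<^esub>" a'] by simp
      show "r \<odot>\<^bsub>A\<^esub> a \<in> {a \<in> carrier A. (\<zero>\<^bsub>B\<^esub>, a) \<in> H}"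
        if "r \<in> carrier L" "a \<in> {a \<in> carrier A. (\<zero>\<^bsub>B\<^esub>, a) \<in> H}" for r a
        using that smult[of "\<zero>\<^bsub>L\<^esub>" "\<zero>\<^bsub>L\<^esub>" r "\<zero>\<^bsub>B\<^esub>" a] mod_homD(1)[OF f]
        by (simp add: A.lm_smult_closed B.lm_smult_l_null)
    qed (use zero in auto)
    then have HA: "{a \<in> carrier A. (\<zero>\<^bsub>B\<^esub>, a) \<in> H} = carrier A"
      by (rule SA(3)) (use SA(2) H(2) in auto)
    have "(b, a) \<in> H" if "b \<in> carrier B" "a \<in> carrier A" for b a
    proof -
      have "(b, \<zero>\<^bsub>A\<^esub>) \<in> H" "(\<zero>\<^bsub>B\<^esub>, a) \<in> H"
        using that HA HB by blast+
      then show ?thesis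
        using add[of b "\<zero>\<^bsub>A\<^esub>" "\<zero>\<^bsub>B\<^esub>" a] that by simp
    qed
    moreover have "H \<subseteq> carrier ?T" using H.subset by simp
    ultimately show ?thesis by (auto simp: tri_module_simps)
  qed
  moreover have "finite ?S" "?S \<subseteq> carrier ?T"
    using SA(1,2) SB(1,2) by auto
  ultimately show ?thesis
    using T unfolding fg_module_def fin_gen_def by blast
qed

lemma tri_short_exact:
  assumes ob: "mor_object L (C, c, C')" "mor_object L (B, b, B')" "mor_object L (A, a, A')"
    and hom: "(f, f') \<in> mor_hom L (C, c, C') (B, b, B')" "(g, g') \<in> mor_hom L (B, b, B') (A, a, A')"
    and E: "short_exact L C f B g A" and E': "short_exact L C' f' B' g' A'"
  shows "short_exact (T2 L) (tri_module (C, c, C')) (tri_map (f, f')) (tri_module (B, b, B'))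
    (tri_map (g, g')) (tri_module (A, a, A'))"
proof -
  have ker: "f ` carrier C = {x \<in> carrier B. g x = \<zero>\<^bsub>A\<^esub>}"
    "f' ` carrier C' = {x \<in> carrier B'. g' x = \<zero>\<^bsub>A'\<^esub>}"
    and im: "g ` carrier B = carrier A" "g' ` carrier B' = carrier A'"
    and inj: "inj_on f (carrier C)" "inj_on f' (carrier C')"
    using E E' by (simp_all add: short_exact_def)
  have "tri_map (f, f') ` (carrier C' \<times> carrier C) = f' ` carrier C' \<times> f ` carrier C"
    "tri_map (g, g') ` (carrier B' \<times> carrier B) = g' ` carrier B' \<times> g ` carrier B"
    by (simp_all add: map_prod_surj_on[OF refl refl])
  moreover have "inj_on (tri_map (f, f')) (carrier C' \<times> carrier C)"
    using map_prod_inj_on[OF inj(2,1)] by simp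
  ultimately show ?thesis
    using fg_tri_module[OF ob(1)] fg_tri_module[OF ob(2)] fg_tri_module[OF ob(3)]
      tri_map_mod_hom[OF ob(1,2) hom(1)] tri_map_mod_hom[OF ob(2,3) hom(2)]
    unfolding short_exact_def tri_module_simps ker im by auto
qed

section \<open>Fullness and density of the passage to triangular matrices\<close>

text \<open>Fullness: commuting with the two diagonal idempotents makes \<open>k\<close> preserve
  the coordinate axes, which yields \<open>h1\<close> and \<open>h2\<close>; commuting with the
  upper right matrix unit is the commutativity of the square.\<close>

lemma tri_module_hom_cases:
  assumes M: "left_module L M" "left_module L N" "m \<in> mod_hom L M N"
    and A: "left_module L A" "left_module L B" "f \<in> mod_hom L A B"
    and k: "k \<in> mod_hom (T2 L) (tri_module (M, m, N)) (tri_module (A, f, B))"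
  obtains h1 h2 where "(h1, h2) \<in> mor_hom L (M, m, N) (A, f, B)"
    "\<And>x. x \<in> carrier (tri_module (M, m, N)) \<Longrightarrow> k x = tri_map (h1, h2) x"
proof -
  interpret M: left_module L M by (rule M)
  interpret N: left_module L N by (rule M)
  interpret A: left_module L A by (rule A)
  interpret B: left_module L B by (rule A)
  let ?T = "tri_module (M, m, N)" and ?U = "tri_module (A, f, B)"
  define h1 where "h1 x = snd (k (\<zero>\<^bsub>N\<^esub>, x))" for x
  define h2 where "h2 x = fst (k (x, \<zero>\<^bsub>M\<^esub>))" for x
  note [simp] = mod_homD(1)[OF M(3)] mod_homD(1)[OF A(3)] M.lm_smult_closed N.lm_smult_closed
    A.lm_smult_closed B.lm_smult_closed M.lm_smult_one N.lm_smult_one A.lm_smult_one B.lm_smult_one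
    M.lm_smult_l_null N.lm_smult_l_null A.lm_smult_l_null B.lm_smult_l_null
    M.lm_smult_r_null N.lm_smult_r_null mod_hom_zero[OF M(3,1,2)]
  have closed: "k (b, a) \<in> carrier B \<times> carrier A" if "b \<in> carrier N" "a \<in> carrier M" for a b
    using mod_homD(1)[OF k, of "(b, a)"] that by simp
  have smult: "k ((x, y, z) \<odot>\<^bsub>?T\<^esub> (b, a)) = (x, y, z) \<odot>\<^bsub>?U\<^esub> k (b, a)"
    if "x \<in> carrier L" "y \<in> carrier L" "z \<in> carrier L" "b \<in> carrier N" "a \<in> carrier M" for x y z a b
    using mod_homD(3)[OF k, of "(x, y, z)" "(b, a)"] that by (simp del: tri_module.simps add: tri_module_simps(1))
  have k1: "k (\<zero>\<^bsub>N\<^esub>, x) = (\<zero>\<^bsub>B\<^esub>, h1 x)" and h1c: "h1 x \<in> carrier A" if x: "x \<in> carrier M" for x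
  proof -
    obtain b a where ba: "k (\<zero>\<^bsub>N\<^esub>, x) = (b, a)" by (rule prod.exhaust)
    have c: "b \<in> carrier B" "a \<in> carrier A"
      using closed[OF N.M.zero_closed x] by (simp_all add: ba)
    \<comment> \<open>The lower diagonal idempotent fixes the argument and annihilates the upper
      coordinate of the value.\<close>
    have "(b, a) = (\<zero>\<^bsub>B\<^esub>, a)"
      using smult[of "\<zero>\<^bsub>L\<^esub>" "\<zero>\<^bsub>L\<^esub>" "\<one>\<^bsub>L\<^esub>" "\<zero>\<^bsub>N\<^esub>" x] x c by (simp add: ba)
    then show "k (\<zero>\<^bsub>N\<^esub>, x) = (\<zero>\<^bsub>B\<^esub>, h1 x)" "h1 x \<in> carrier A"
      using c by (simp_all add: h1_def ba)
  qed
  have k2: "k (x, \<zero>\<^bsub>M\<^esub>) = (h2 x, \<zero>\<^bsub>A\<^esub>)" and h2c: "h2 x \<in> carrier B" if x: "x \<in> carrier N" for x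
  proof -
    obtain b a where ba: "k (x, \<zero>\<^bsub>M\<^esub>) = (b, a)" by (rule prod.exhaust)
    have c: "b \<in> carrier B" "a \<in> carrier A"
      using closed[OF x M.M.zero_closed] by (simp_all add: ba)
    have "(b, a) = (b, \<zero>\<^bsub>A\<^esub>)"
      using smult[of "\<one>\<^bsub>L\<^esub>" "\<zero>\<^bsub>L\<^esub>" "\<zero>\<^bsub>L\<^esub>" x "\<zero>\<^bsub>M\<^esub>"] x c by (simp add: ba)
    then show "k (x, \<zero>\<^bsub>M\<^esub>) = (h2 x, \<zero>\<^bsub>A\<^esub>)" "h2 x \<in> carrier B"
      using c by (simp_all add: h2_def ba)
  qed
  have add: "k (b \<oplus>\<^bsub>N\<^esub> b', a \<oplus>\<^bsub>M\<^esub> a') = k (b, a) \<oplus>\<^bsub>?U\<^esub> k (b', a')"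
    if "b \<in> carrier N" "a \<in> carrier M" "b' \<in> carrier N" "a' \<in> carrier M" for a b a' b'
    using mod_homD(2)[OF k, of "(b, a)" "(b', a')"] that
    by (simp del: tri_module.simps add: tri_module_simps)
  have h1: "h1 \<in> mod_hom L M A"
  proof (rule mod_homI)
    show "h1 (x \<oplus>\<^bsub>M\<^esub> y) = h1 x \<oplus>\<^bsub>A\<^esub> h1 y" if "x \<in> carrier M" "y \<in> carrier M" for x y
      using add[of "\<zero>\<^bsub>N\<^esub>" x "\<zero>\<^bsub>N\<^esub>" y] that by (simp add: k1)
    show "h1 (r \<odot>\<^bsub>M\<^esub> x) = r \<odot>\<^bsub>A\<^esub> h1 x" if "r \<in> carrier L" "x \<in> carrier M" for r x
      using smult[of "\<zero>\<^bsub>L\<^esub>" "\<zero>\<^bsub>L\<^esub>" r "\<zero>\<^bsub>N\<^esub>" x] that by (simp add: k1)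
  qed (rule h1c)
  have h2: "h2 \<in> mod_hom L N B"
  proof (rule mod_homI)
    show "h2 (x \<oplus>\<^bsub>N\<^esub> y) = h2 x \<oplus>\<^bsub>B\<^esub> h2 y" if "x \<in> carrier N" "y \<in> carrier N" for x y
      using add[of x "\<zero>\<^bsub>M\<^esub>" y "\<zero>\<^bsub>M\<^esub>"] that by (simp add: k2)
    show "h2 (r \<odot>\<^bsub>N\<^esub> x) = r \<odot>\<^bsub>B\<^esub> h2 x" if "r \<in> carrier L" "x \<in> carrier N" for r x
      using smult[of r "\<zero>\<^bsub>L\<^esub>" "\<zero>\<^bsub>L\<^esub>" x "\<zero>\<^bsub>M\<^esub>"] that h2c mod_hom_zero[OF A(3,1,2)]
      by (simp add: k2)
  qed (rule h2c)
  \<comment> \<open>The matrix unit \<open>(0, 1, 0)\<close> sends the pair \<open>(0, x)\<close> to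
    \<open>(m x, 0)\<close>, and its image \<open>(0, h1 x)\<close> to
    \<open>(f (h1 x), 0)\<close>.\<close>
  have "f (h1 x) = h2 (m x)" if "x \<in> carrier M" for x
    using smult[of "\<zero>\<^bsub>L\<^esub>" "\<one>\<^bsub>L\<^esub>" "\<zero>\<^bsub>L\<^esub>" "\<zero>\<^bsub>N\<^esub>" x] that h1c by (simp add: k1 k2)
  then have "(h1, h2) \<in> mor_hom L (M, m, N) (A, f, B)"
    using h1 h2 by simp
  moreover have "k x = tri_map (h1, h2) x" if t: "x \<in> carrier ?T" for x
  proof -
    obtain b a where x: "x = (b, a)" "b \<in> carrier N" "a \<in> carrier M"
      using t by (cases x) simp
    show ?thesis
      using add[of b "\<zero>\<^bsub>M\<^esub>" "\<zero>\<^bsub>N\<^esub>" a] x by (simp add: k1 k2 h1c h2c)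
  qed
  ultimately show thesis by (rule that)
qed

text \<open>For an additive and multiplicative (not necessarily unital) map \<open>j\<close> from \<open>L\<close> to the ring of
  scalars of \<open>V\<close>, this is the \<open>L\<close>-module \<open>e V\<close> with \<open>e\<close> the idempotent \<open>j 1\<close>. The two diagonal
  embeddings of \<open>L\<close> into \<open>T2 L\<close> recover both ends of an object of the morphism category.\<close>

definition corner_module ::
  "('r \<Rightarrow> 't) \<Rightarrow> ('r, 'z) ring_scheme \<Rightarrow> ('t, 'm) module \<Rightarrow> ('r, 'm) module" where
  "corner_module j L V =
     \<lparr>carrier = {x \<in> carrier V. j \<one>\<^bsub>L\<^esub> \<odot>\<^bsub>V\<^esub> x = x}, monoid.mult = undefined, monoid.one = undefined,
      ring.zero = \<zero>\<^bsub>V\<^esub>, ring.add = (\<lambda>x y. x \<oplus>\<^bsub>V\<^esub> y), smult = (\<lambda>r x. j r \<odot>\<^bsub>V\<^esub> x)\<rparr>"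

lemma corner_module_simps [simp]:
  "carrier (corner_module j L V) = {x \<in> carrier V. j \<one>\<^bsub>L\<^esub> \<odot>\<^bsub>V\<^esub> x = x}"
  "\<zero>\<^bsub>corner_module j L V\<^esub> = \<zero>\<^bsub>V\<^esub>"
  "x \<oplus>\<^bsub>corner_module j L V\<^esub> y = x \<oplus>\<^bsub>V\<^esub> y"
  "r \<odot>\<^bsub>corner_module j L V\<^esub> x = j r \<odot>\<^bsub>V\<^esub> x"
  by (simp_all add: corner_module_def)

lemma corner_left_module:
  assumes L: "ring L" and V: "left_module T V"
    and closed: "\<And>r. r \<in> carrier L \<Longrightarrow> j r \<in> carrier T"
    and add: "\<And>r q. \<lbrakk>r \<in> carrier L; q \<in> carrier L\<rbrakk> \<Longrightarrow> j (r \<oplus>\<^bsub>L\<^esub> q) = j r \<oplus>\<^bsub>T\<^esub> j q"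
    and mult: "\<And>r q. \<lbrakk>r \<in> carrier L; q \<in> carrier L\<rbrakk> \<Longrightarrow> j (r \<otimes>\<^bsub>L\<^esub> q) = j r \<otimes>\<^bsub>T\<^esub> j q"
  shows "left_module L (corner_module j L V)"
proof -
  interpret L: ring L by (rule L)
  interpret V: left_module T V by (rule V)
  let ?Y = "corner_module j L V"
  have act: "j r \<odot>\<^bsub>V\<^esub> (j q \<odot>\<^bsub>V\<^esub> x) = j (r \<otimes>\<^bsub>L\<^esub> q) \<odot>\<^bsub>V\<^esub> x"
    if "r \<in> carrier L" "q \<in> carrier L" "x \<in> carrier V" for r q x
    using that by (simp add: mult closed V.lm_smult_assoc)
  have j0: "j \<zero>\<^bsub>L\<^esub> = \<zero>\<^bsub>T\<^esub>"
    using add[of "\<zero>\<^bsub>L\<^esub>" "\<zero>\<^bsub>L\<^esub>"] closed[of "\<zero>\<^bsub>L\<^esub>"] by simp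
  note [simp] = V.lm_smult_closed closed
  have "abelian_group ?Y"
  proof (rule abelian_groupI)
    show "\<exists>y\<in>carrier ?Y. y \<oplus>\<^bsub>?Y\<^esub> x = \<zero>\<^bsub>?Y\<^esub>" if "x \<in> carrier ?Y" for x
    proof (rule bexI)
      have x: "x \<in> carrier V" "j \<one>\<^bsub>L\<^esub> \<odot>\<^bsub>V\<^esub> x = x" using that by simp_all
      \<comment> \<open>Additivity gives \<open>j (-1) + j 1 = j 0 = 0\<close>, and
        \<open>j 1\<close> acts as the identity on the corner, so \<open>j (-1)\<close> acts as
        negation.\<close>
      have "j (\<ominus>\<^bsub>L\<^esub> \<one>\<^bsub>L\<^esub>) \<odot>\<^bsub>V\<^esub> x \<oplus>\<^bsub>V\<^esub> j \<one>\<^bsub>L\<^esub> \<odot>\<^bsub>V\<^esub> x = \<zero>\<^bsub>V\<^esub>"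
        using x(1) by (simp add: V.lm_smult_l_distr[symmetric] add[symmetric] L.l_neg j0
            V.lm_smult_l_null)
      then show "j (\<ominus>\<^bsub>L\<^esub> \<one>\<^bsub>L\<^esub>) \<odot>\<^bsub>V\<^esub> x \<oplus>\<^bsub>?Y\<^esub> x = \<zero>\<^bsub>?Y\<^esub>" using x(2) by simp
      show "j (\<ominus>\<^bsub>L\<^esub> \<one>\<^bsub>L\<^esub>) \<odot>\<^bsub>V\<^esub> x \<in> carrier ?Y" using x(1) by (simp add: act)
    qed
  qed (auto simp: V.M.a_ac V.lm_smult_r_distr V.lm_smult_r_null)
  then show ?thesis
    by (intro left_module.intro left_module_axioms.intro L)
      (auto simp: act V.lm_smult_l_distr V.lm_smult_r_distr add)
qed

text \<open>With \<open>e\<close> the idempotent \<open>j 1\<close>, the finite set \<open>G\<close>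
  spans \<open>e (T2 L)\<close> over \<open>L\<close>: it contains \<open>e\<close>, and
  \<open>expand\<close> makes its span stable under right multiplication. Hence the products of
  \<open>G\<close> with generators of \<open>V\<close> generate \<open>e V\<close>. Two summands
  suffice because a row of a triangular matrix has at most two entries.\<close>

lemma fg_corner_module:
  assumes L: "ring L" and V: "fg_module (T2 L) V"
    and corner: "left_module L (corner_module j L V)"
    and G: "finite G" "G \<subseteq> carrier (T2 L)"
    and G_corner: "\<And>c. c \<in> G \<Longrightarrow> j \<one>\<^bsub>L\<^esub> \<otimes>\<^bsub>T2 L\<^esub> c = c"
    and unit: "j \<one>\<^bsub>L\<^esub> \<in> G"
    and expand: "\<And>c a. \<lbrakk>c \<in> G; a \<in> carrier (T2 L)\<rbrakk> \<Longrightarrow>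
      \<exists>r c' q c''. r \<in> carrier L \<and> c' \<in> G \<and> q \<in> carrier L \<and> c'' \<in> G \<and> j r \<in> carrier (T2 L) \<and>
        j q \<in> carrier (T2 L) \<and> c \<otimes>\<^bsub>T2 L\<^esub> a = j r \<otimes>\<^bsub>T2 L\<^esub> c' \<oplus>\<^bsub>T2 L\<^esub> j q \<otimes>\<^bsub>T2 L\<^esub> c''"
  shows "fg_module L (corner_module j L V)"
proof -
  interpret T: ring "T2 L" by (rule T2_ring[OF L])
  interpret V: left_module "T2 L" V by (rule fg_left_module[OF V])
  let ?Y = "corner_module j L V"
  interpret Y: left_module L ?Y by (rule corner)
  obtain S where S: "finite S" "S \<subseteq> carrier V"
    "\<And>H. \<lbrakk>submodule H (T2 L) V; S \<subseteq> H\<rbrakk> \<Longrightarrow> H = carrier V"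
    using V unfolding fg_module_def fin_gen_def by blast
  have Gc: "c \<in> carrier (T2 L)" if "c \<in> G" for c
    using G(2) that by (rule subsetD)
  let ?S = "(\<lambda>(c, x). c \<odot>\<^bsub>V\<^esub> x) ` (G \<times> S)"
  have "H = carrier ?Y" if H: "submodule H L ?Y" "?S \<subseteq> H" for H
  proof -
    interpret H: submodule H L ?Y by (rule H(1))
    have HX: "x \<in> carrier V" "j \<one>\<^bsub>L\<^esub> \<odot>\<^bsub>V\<^esub> x = x" if "x \<in> H" for x
      using subsetD[OF H.subset, of x] that by simp_all
    have zero: "\<zero>\<^bsub>V\<^esub> \<in> H" using H.one_closed by simp
    have add: "x \<oplus>\<^bsub>V\<^esub> y \<in> H" if "x \<in> H" "y \<in> H" for x y using H.m_closed[OF that] by simp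
    have smult: "j r \<odot>\<^bsub>V\<^esub> x \<in> H" if "r \<in> carrier L" "x \<in> H" for r x
      using H.smult_closed[OF that] by simp
    \<comment> \<open>By \<open>expand\<close>, the elements that all of \<open>G\<close> sends into
      \<open>H\<close> form a submodule over the whole of \<open>T2 L\<close>. It contains
      \<open>S\<close>, hence is \<open>V\<close>; applying \<open>j 1\<close>, a member of
      \<open>G\<close>, then puts the corner into \<open>H\<close>.\<close>
    let ?H' = "{x \<in> carrier V. \<forall>c\<in>G. c \<odot>\<^bsub>V\<^esub> x \<in> H}"
    have "submodule ?H' (T2 L) V"
    proof (rule V.lm_submoduleI)
      fix a x assume a: "a \<in> carrier (T2 L)" and x: "x \<in> ?H'"
      have "c \<odot>\<^bsub>V\<^esub> (a \<odot>\<^bsub>V\<^esub> x) \<in> H" if c: "c \<in> G" for c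
      proof -
        obtain r c' q c'' where *: "r \<in> carrier L" "c' \<in> G" "q \<in> carrier L" "c'' \<in> G"
          "j r \<in> carrier (T2 L)" "j q \<in> carrier (T2 L)"
          "c \<otimes>\<^bsub>T2 L\<^esub> a = j r \<otimes>\<^bsub>T2 L\<^esub> c' \<oplus>\<^bsub>T2 L\<^esub> j q \<otimes>\<^bsub>T2 L\<^esub> c''"
          using expand[OF c a] by blast
        have xX: "x \<in> carrier V" using x by simp
        have "c \<odot>\<^bsub>V\<^esub> (a \<odot>\<^bsub>V\<^esub> x) = (c \<otimes>\<^bsub>T2 L\<^esub> a) \<odot>\<^bsub>V\<^esub> x"
          by (rule V.lm_smult_assoc[OF Gc[OF c] a xX, symmetric])
        also have "\<dots> = j r \<odot>\<^bsub>V\<^esub> (c' \<odot>\<^bsub>V\<^esub> x) \<oplus>\<^bsub>V\<^esub> j q \<odot>\<^bsub>V\<^esub> (c'' \<odot>\<^bsub>V\<^esub> x)"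
          using V.lm_smult_l_distr[OF T.m_closed[OF *(5) Gc[OF *(2)]] T.m_closed[OF *(6) Gc[OF *(4)]] xX]
            V.lm_smult_assoc[OF *(5) Gc[OF *(2)] xX] V.lm_smult_assoc[OF *(6) Gc[OF *(4)] xX]
          by (simp only: *(7))
        also have "\<dots> \<in> H"
          using x * by (intro add smult) auto
        finally show ?thesis .
      qed
      then show "a \<odot>\<^bsub>V\<^esub> x \<in> ?H'"
        using a x V.lm_smult_closed by blast
    next
      show "x \<oplus>\<^bsub>V\<^esub> y \<in> ?H'" if "x \<in> ?H'" "y \<in> ?H'" for x y
        using that add Gc by (auto simp: V.lm_smult_r_distr)
      show "\<zero>\<^bsub>V\<^esub> \<in> ?H'" using zero Gc by (auto simp: V.lm_smult_r_null)
    qed auto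
    moreover have "S \<subseteq> ?H'" using S(2) H(2) by auto
    ultimately have H': "?H' = carrier V" by (rule S(3))
    have "carrier ?Y \<subseteq> H"
    proof
      fix x assume "x \<in> carrier ?Y"
      then have x: "x \<in> carrier V" "j \<one>\<^bsub>L\<^esub> \<odot>\<^bsub>V\<^esub> x = x" by simp_all
      then have "x \<in> ?H'" by (simp only: H')
      then have "j \<one>\<^bsub>L\<^esub> \<odot>\<^bsub>V\<^esub> x \<in> H" using unit by blast
      then show "x \<in> H" by (simp only: x(2))
    qed
    then show ?thesis using H.subset by (intro equalityI) simp_all
  qed
  moreover have "finite ?S" using G(1) S(1) by simp
  moreover have "?S \<subseteq> carrier ?Y"
  proof
    fix y assume "y \<in> ?S"
    then obtain c x where y: "y = c \<odot>\<^bsub>V\<^esub> x" "c \<in> G" "x \<in> S" by auto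
    then have x: "x \<in> carrier V" using S(2) by blast
    have "j \<one>\<^bsub>L\<^esub> \<odot>\<^bsub>V\<^esub> (c \<odot>\<^bsub>V\<^esub> x) = c \<odot>\<^bsub>V\<^esub> x"
      using V.lm_smult_assoc[OF Gc[OF unit] Gc[OF y(2)] x] by (simp only: G_corner[OF y(2)])
    then show "y \<in> carrier ?Y"
      using V.lm_smult_closed[OF Gc[OF y(2)] x] by (simp add: y(1))
  qed
  ultimately show ?thesis
    using corner unfolding fg_module_def fin_gen_def by blast
qed

text \<open>Density, by the Peirce decomposition of \<open>V\<close> for the idempotents
  \<open>j1 1\<close> and \<open>j2 1\<close>. The upper right matrix unit acts as \<open>m\<close>,
  and as the idempotents sum to one, addition in \<open>V\<close> inverts \<open>\<phi>\<close>.
  Both corners are subsets of \<open>V\<close> and keep its element type.\<close>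

lemma tri_module_decomposition:
  fixes L :: "('r, 'z) ring_scheme" and V :: "('r \<times> 'r \<times> 'r, 'm) module"
  assumes L: "ring L" and V: "fg_module (T2 L) V"
  obtains M N :: "('r, 'm) module" and m \<phi> where "mor_object L (M, m, N)"
    "\<phi> \<in> mod_hom (T2 L) V (tri_module (M, m, N))"
    "bij_betw \<phi> (carrier V) (carrier (tri_module (M, m, N)))"
proof -
  interpret L: ring L by (rule L)
  interpret T: ring "T2 L" by (rule T2_ring[OF L])
  interpret V: left_module "T2 L" V by (rule fg_left_module[OF V])
  define j1 :: "'r \<Rightarrow> 'r \<times> 'r \<times> 'r" where "j1 r = (r, \<zero>\<^bsub>L\<^esub>, \<zero>\<^bsub>L\<^esub>)" for r
  define j2 :: "'r \<Rightarrow> 'r \<times> 'r \<times> 'r" where "j2 r = (\<zero>\<^bsub>L\<^esub>, \<zero>\<^bsub>L\<^esub>, r)" for r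
  define N where "N = corner_module j1 L V"
  define M where "M = corner_module j2 L V"
  define m where "m x = (\<zero>\<^bsub>L\<^esub>, \<one>\<^bsub>L\<^esub>, \<zero>\<^bsub>L\<^esub>) \<odot>\<^bsub>V\<^esub> x" for x
  define \<phi> where "\<phi> x = (j1 \<one>\<^bsub>L\<^esub> \<odot>\<^bsub>V\<^esub> x, j2 \<one>\<^bsub>L\<^esub> \<odot>\<^bsub>V\<^esub> x)" for x
  have jc: "j1 r \<in> carrier (T2 L)" "j2 r \<in> carrier (T2 L)" if "r \<in> carrier L" for r
    using that by (simp_all add: j1_def j2_def)
  have lmN: "left_module L N" unfolding N_def
    by (rule corner_left_module[OF L V.left_module_axioms jc(1)]) (simp_all add: j1_def)
  have lmM: "left_module L M" unfolding M_def
    by (rule corner_left_module[OF L V.left_module_axioms jc(2)]) (simp_all add: j2_def)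
  have fgN: "fg_module L N"
    unfolding N_def
  proof (rule fg_corner_module[OF L V lmN[unfolded N_def],
        of "{j1 \<one>\<^bsub>L\<^esub>, (\<zero>\<^bsub>L\<^esub>, \<one>\<^bsub>L\<^esub>, \<zero>\<^bsub>L\<^esub>)}"])
    fix c a assume c: "c \<in> {j1 \<one>\<^bsub>L\<^esub>, (\<zero>\<^bsub>L\<^esub>, \<one>\<^bsub>L\<^esub>, \<zero>\<^bsub>L\<^esub>)}" and a: "a \<in> carrier (T2 L)"
    obtain x y z where a': "a = (x, y, z)" "x \<in> carrier L" "y \<in> carrier L" "z \<in> carrier L"
      using a by (cases a) auto
    show "\<exists>r c' q c''. r \<in> carrier L \<and> c' \<in> {j1 \<one>\<^bsub>L\<^esub>, (\<zero>\<^bsub>L\<^esub>, \<one>\<^bsub>L\<^esub>, \<zero>\<^bsub>L\<^esub>)} \<and> q \<in> carrier L \<and>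
        c'' \<in> {j1 \<one>\<^bsub>L\<^esub>, (\<zero>\<^bsub>L\<^esub>, \<one>\<^bsub>L\<^esub>, \<zero>\<^bsub>L\<^esub>)} \<and> j1 r \<in> carrier (T2 L) \<and> j1 q \<in> carrier (T2 L) \<and>
        c \<otimes>\<^bsub>T2 L\<^esub> a = j1 r \<otimes>\<^bsub>T2 L\<^esub> c' \<oplus>\<^bsub>T2 L\<^esub> j1 q \<otimes>\<^bsub>T2 L\<^esub> c''"
    \<comment> \<open>The two matrix units of the first row span it: for
      \<open>a = (x, y, z)\<close> the diagonal one gives coefficients \<open>x\<close> and
      \<open>y\<close>, the other one gives \<open>0\<close> and \<open>z\<close>.\<close>
    proof (cases "c = j1 \<one>\<^bsub>L\<^esub>")
      case True
      show ?thesis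
        by (rule exI[of _ x], rule exI[of _ "j1 \<one>\<^bsub>L\<^esub>"], rule exI[of _ y],
            rule exI[of _ "(\<zero>\<^bsub>L\<^esub>, \<one>\<^bsub>L\<^esub>, \<zero>\<^bsub>L\<^esub>)"]) (use a' True in \<open>simp add: j1_def\<close>)
    next
      case False
      then have c': "c = (\<zero>\<^bsub>L\<^esub>, \<one>\<^bsub>L\<^esub>, \<zero>\<^bsub>L\<^esub>)" using c by simp
      show ?thesis
        by (rule exI[of _ "\<zero>\<^bsub>L\<^esub>"], rule exI[of _ "j1 \<one>\<^bsub>L\<^esub>"], rule exI[of _ z],
            rule exI[of _ "(\<zero>\<^bsub>L\<^esub>, \<one>\<^bsub>L\<^esub>, \<zero>\<^bsub>L\<^esub>)"]) (use a' c' in \<open>simp add: j1_def\<close>)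
    qed
  qed (auto simp: j1_def)
  have fgM: "fg_module L M"
    unfolding M_def
  proof (rule fg_corner_module[OF L V lmM[unfolded M_def], of "{j2 \<one>\<^bsub>L\<^esub>}"])
    fix c a assume c: "c \<in> {j2 \<one>\<^bsub>L\<^esub>}" and a: "a \<in> carrier (T2 L)"
    obtain x y z where a': "a = (x, y, z)" "x \<in> carrier L" "y \<in> carrier L" "z \<in> carrier L"
      using a by (cases a) auto
    show "\<exists>r c' q c''. r \<in> carrier L \<and> c' \<in> {j2 \<one>\<^bsub>L\<^esub>} \<and> q \<in> carrier L \<and>
        c'' \<in> {j2 \<one>\<^bsub>L\<^esub>} \<and> j2 r \<in> carrier (T2 L) \<and> j2 q \<in> carrier (T2 L) \<and>
        c \<otimes>\<^bsub>T2 L\<^esub> a = j2 r \<otimes>\<^bsub>T2 L\<^esub> c' \<oplus>\<^bsub>T2 L\<^esub> j2 q \<otimes>\<^bsub>T2 L\<^esub> c''"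
      \<comment> \<open>The second row has a single entry, so the second summand is padded with
        coefficient zero.\<close>
      by (rule exI[of _ z], rule exI[of _ "j2 \<one>\<^bsub>L\<^esub>"], rule exI[of _ "\<zero>\<^bsub>L\<^esub>"],
          rule exI[of _ "j2 \<one>\<^bsub>L\<^esub>"]) (use a' c in \<open>simp add: j2_def\<close>)
  qed (auto simp: j2_def)
  have act: "a \<odot>\<^bsub>V\<^esub> (b \<odot>\<^bsub>V\<^esub> x) = (a \<otimes>\<^bsub>T2 L\<^esub> b) \<odot>\<^bsub>V\<^esub> x"
    if "a \<in> carrier (T2 L)" "b \<in> carrier (T2 L)" "x \<in> carrier V" for a b x
    by (rule V.lm_smult_assoc[OF that, symmetric])
  note [simp] = V.lm_smult_closed
  have m: "m \<in> mod_hom L M N"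
    by (rule mod_homI)
      (auto simp: M_def N_def m_def act j1_def j2_def V.lm_smult_r_distr)
  have \<phi>: "\<phi> \<in> mod_hom (T2 L) V (tri_module (M, m, N))"
  proof (rule mod_homI)
    fix a x assume a: "a \<in> carrier (T2 L)" and x: "x \<in> carrier V"
    obtain \<alpha> \<beta> \<gamma> where a': "a = (\<alpha>, \<beta>, \<gamma>)" "\<alpha> \<in> carrier L" "\<beta> \<in> carrier L" "\<gamma> \<in> carrier L"
      using a by (cases a) auto
    show "\<phi> (a \<odot>\<^bsub>V\<^esub> x) = a \<odot>\<^bsub>tri_module (M, m, N)\<^esub> \<phi> x"
      using x a' by (simp add: \<phi>_def N_def M_def m_def act j1_def j2_def
          V.lm_smult_l_distr[symmetric])
  qed (auto simp: \<phi>_def N_def M_def act j1_def j2_def V.lm_smult_r_distr)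
  have "bij_betw \<phi> (carrier V) (carrier (tri_module (M, m, N)))"
  proof (rule bij_betwI[where g = "\<lambda>(b, a). b \<oplus>\<^bsub>V\<^esub> a"])
    show "\<phi> \<in> carrier V \<rightarrow> carrier (tri_module (M, m, N))"
      using mod_homD(1)[OF \<phi>] by blast
    show "(\<lambda>(b, a). b \<oplus>\<^bsub>V\<^esub> a) \<in> carrier (tri_module (M, m, N)) \<rightarrow> carrier V"
      by (auto simp: N_def M_def)
    show "(\<lambda>(b, a). b \<oplus>\<^bsub>V\<^esub> a) (\<phi> x) = x" if "x \<in> carrier V" for x
      using that V.lm_smult_one[OF that]
      by (simp add: \<phi>_def j1_def j2_def V.lm_smult_l_distr[symmetric])
    show "\<phi> ((\<lambda>(b, a). b \<oplus>\<^bsub>V\<^esub> a) y) = y" if t: "y \<in> carrier (tri_module (M, m, N))" for y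
    proof -
      obtain b a where y: "y = (b, a)" "b \<in> carrier N" "a \<in> carrier M"
        using t by (cases y) simp
      then have c: "b \<in> carrier V" "j1 \<one>\<^bsub>L\<^esub> \<odot>\<^bsub>V\<^esub> b = b" "a \<in> carrier V" "j2 \<one>\<^bsub>L\<^esub> \<odot>\<^bsub>V\<^esub> a = a"
        by (simp_all add: N_def M_def)
      \<comment> \<open>The two idempotents are orthogonal, so each projection of
        \<open>b + a\<close> retains exactly one summand.\<close>
      have "j1 \<one>\<^bsub>L\<^esub> \<odot>\<^bsub>V\<^esub> (j2 \<one>\<^bsub>L\<^esub> \<odot>\<^bsub>V\<^esub> a) = \<zero>\<^bsub>V\<^esub>" "j2 \<one>\<^bsub>L\<^esub> \<odot>\<^bsub>V\<^esub> (j1 \<one>\<^bsub>L\<^esub> \<odot>\<^bsub>V\<^esub> b) = \<zero>\<^bsub>V\<^esub>"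
        using c(1,3) V.lm_smult_l_null by (simp_all add: act j1_def j2_def)
      then show ?thesis
        using c jc[OF L.one_closed] by (simp add: y(1) \<phi>_def V.lm_smult_r_distr)
    qed
  qed
  then show thesis
    using that[of M m N \<phi>] fgM fgN m \<phi> by simp
qed

text \<open>Test modules over \<^term>\<open>T2 L\<close> consist of lists of triples, hence the types of \<open>M\<close> and \<open>N\<close>.\<close>

lemma tri_right_almost_split:
  fixes L :: "('r, 'k) ring_scheme"
  assumes L: "ring L" and B: "mor_object L (B, b, B')" and A: "mor_object L (A, a, A')"
    and g: "(g, g') \<in> mor_hom L (B, b, B') (A, a, A')"
    and not_split: "\<not> (\<exists>t t'. (t, t') \<in> mor_hom L (A, a, A') (B, b, B') \<and>
      (\<forall>x\<in>carrier A. g (t x) = x) \<and> (\<forall>x\<in>carrier A'. g' (t' x) = x))"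
    and lift: "\<And>(M :: ('r, ('r \<times> 'r \<times> 'r) list) module) m (N :: ('r, ('r \<times> 'r \<times> 'r) list) module) k k'.
      \<lbrakk>mor_object L (M, m, N); (k, k') \<in> mor_hom L (M, m, N) (A, a, A')\<rbrakk> \<Longrightarrow>
      (\<exists>t t'. (t, t') \<in> mor_hom L (M, m, N) (B, b, B') \<and>
        (\<forall>x\<in>carrier M. g (t x) = k x) \<and> (\<forall>x\<in>carrier N. g' (t' x) = k' x)) \<or>
      (\<exists>t t'. (t, t') \<in> mor_hom L (A, a, A') (M, m, N) \<and>
        (\<forall>x\<in>carrier A. k (t x) = x) \<and> (\<forall>x\<in>carrier A'. k' (t' x) = x))"
  shows "right_almost_split (T2 L) (tri_module (B, b, B')) (tri_map (g, g')) (tri_module (A, a, A'))"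
  unfolding right_almost_split_def
proof (intro conjI allI impI)
  have lmA: "left_module L A" "left_module L A'" "a \<in> mod_hom L A A'"
    and lmB: "left_module L B" "left_module L B'" "b \<in> mod_hom L B B'"
    using A B by (simp_all add: fg_left_module)
  show "tri_map (g, g') \<in> mod_hom (T2 L) (tri_module (B, b, B')) (tri_module (A, a, A'))"
    by (rule tri_map_mod_hom[OF B A g])
  show "\<not> split_epi (T2 L) (tri_module (B, b, B')) (tri_map (g, g')) (tri_module (A, a, A'))"
  proof
    assume "split_epi (T2 L) (tri_module (B, b, B')) (tri_map (g, g')) (tri_module (A, a, A'))"
    then obtain \<tau> where \<tau>: "\<tau> \<in> mod_hom (T2 L) (tri_module (A, a, A')) (tri_module (B, b, B'))"
      "\<And>x. x \<in> carrier (tri_module (A, a, A')) \<Longrightarrow> tri_map (g, g') (\<tau> x) = x"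
      by (auto simp only: split_epi_def)
    obtain t t' where t: "(t, t') \<in> mor_hom L (A, a, A') (B, b, B')"
      "\<And>x. x \<in> carrier (tri_module (A, a, A')) \<Longrightarrow> \<tau> x = tri_map (t, t') x"
      using tri_module_hom_cases[OF lmA lmB \<tau>(1)] by blast
    have eq: "(g' (t' x'), g (t x)) = (x', x)" if "x \<in> carrier A" "x' \<in> carrier A'" for x x'
      using \<tau>(2)[of "(x', x)"] t(2)[of "(x', x)"] that by simp
    interpret A: left_module L A by (rule lmA)
    interpret A': left_module L A' by (rule lmA)
    have "g (t x) = x" if "x \<in> carrier A" for x
      using eq[OF that A'.M.zero_closed] by simp
    moreover have "g' (t' x) = x" if "x \<in> carrier A'" for x
      using eq[OF A.M.zero_closed that] by simp
    ultimately show False using t(1) not_split by blast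
  qed
  fix V :: "('r \<times> 'r \<times> 'r) test_module" and k
  assume V': "fg_module (T2 L) V \<and> k \<in> mod_hom (T2 L) V (tri_module (A, a, A')) \<and>
    \<not> split_epi (T2 L) V k (tri_module (A, a, A'))"
  then have V: "fg_module (T2 L) V" and k: "k \<in> mod_hom (T2 L) V (tri_module (A, a, A'))"
    by simp_all
  obtain M N :: "('r, ('r \<times> 'r \<times> 'r) list) module" and m \<phi> where ob: "mor_object L (M, m, N)"
    and \<phi>: "\<phi> \<in> mod_hom (T2 L) V (tri_module (M, m, N))"
    "bij_betw \<phi> (carrier V) (carrier (tri_module (M, m, N)))"
    by (rule tri_module_decomposition[OF L V])
  have lmM: "left_module L M" "left_module L N" "m \<in> mod_hom L M N"
    using ob by (simp_all add: fg_left_module)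
  obtain \<psi> where \<psi>: "\<psi> \<in> mod_hom (T2 L) (tri_module (M, m, N)) V"
    "\<And>x. x \<in> carrier V \<Longrightarrow> \<psi> (\<phi> x) = x"
    using mod_hom_inverse[OF \<phi> fg_left_module[OF V] tri_module_left_module[OF lmM]] by blast
  \<comment> \<open>Density has replaced \<open>V\<close> by the triangular module of
    \<open>(M, m, N)\<close>; fullness now turns the transported map \<open>k \<psi>\<close> into a
    pair, to which \<open>lift\<close> applies.\<close>
  obtain k1 k2 where k12: "(k1, k2) \<in> mor_hom L (M, m, N) (A, a, A')"
    "\<And>x. x \<in> carrier (tri_module (M, m, N)) \<Longrightarrow> k (\<psi> x) = tri_map (k1, k2) x"
    using tri_module_hom_cases[OF lmM lmA mod_hom_comp[OF \<psi>(1) k]] by blast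
  show "\<exists>t\<in>mod_hom (T2 L) V (tri_module (B, b, B')). \<forall>x\<in>carrier V. tri_map (g, g') (t x) = k x"
    using lift[OF ob k12(1)]
  proof (elim disjE exE conjE)
    fix t t' assume t: "(t, t') \<in> mor_hom L (M, m, N) (B, b, B')"
      "\<forall>x\<in>carrier M. g (t x) = k1 x" "\<forall>x\<in>carrier N. g' (t' x) = k2 x"
    show ?thesis
    proof (intro bexI ballI)
      show "(\<lambda>x. tri_map (t, t') (\<phi> x)) \<in> mod_hom (T2 L) V (tri_module (B, b, B'))"
        by (rule mod_hom_comp[OF \<phi>(1) tri_map_mod_hom[OF ob B t(1)]])
      fix x assume x: "x \<in> carrier V"
      obtain y' y where y: "\<phi> x = (y', y)" "y' \<in> carrier N" "y \<in> carrier M"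
        using mod_homD(1)[OF \<phi>(1) x] by (cases "\<phi> x") simp
      have "k x = (k2 y', k1 y)"
        using k12(2)[OF mod_homD(1)[OF \<phi>(1) x]] unfolding \<psi>(2)[OF x] by (simp add: y(1))
      then show "tri_map (g, g') (tri_map (t, t') (\<phi> x)) = k x"
        using t(2,3) y by simp
    qed
  next
    fix t t' assume t: "(t, t') \<in> mor_hom L (A, a, A') (M, m, N)"
      "\<forall>x\<in>carrier A. k1 (t x) = x" "\<forall>x\<in>carrier A'. k2 (t' x) = x"
    have \<tau>: "tri_map (t, t') \<in> mod_hom (T2 L) (tri_module (A, a, A')) (tri_module (M, m, N))"
      by (rule tri_map_mod_hom[OF A ob t(1)])
    have split: "k (\<psi> (tri_map (t, t') x)) = x" if x: "x \<in> carrier (tri_module (A, a, A'))" for x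
    proof -
      obtain y' y where y: "x = (y', y)" "y' \<in> carrier A'" "y \<in> carrier A"
        using x by (cases x) simp
      show ?thesis
        using k12(2)[OF mod_homD(1)[OF \<tau> x]] t(2,3) y by simp
    qed
    have "split_epi (T2 L) V k (tri_module (A, a, A'))"
      unfolding split_epi_def
      by (intro conjI k bexI[OF _ mod_hom_comp[OF \<tau> \<psi>(1)]] ballI split)
    then show ?thesis using V' by blast
  qed
qed

text \<open>Fullness and density reduce tests against modules over \<open>T2 L\<close> to tests
  against objects \<open>(M, m, N)\<close>. Lists of triples suffice as carriers because the corners
  of a test module keep its element type.\<close>

lemma tri_left_almost_split:
  fixes L :: "('r, 'k) ring_scheme"
  assumes L: "ring L" and C: "mor_object L (C, c, C')" and B: "mor_object L (B, b, B')"
    and f: "(f, f') \<in> mor_hom L (C, c, C') (B, b, B')"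
    and not_split: "\<not> (\<exists>t t'. (t, t') \<in> mor_hom L (B, b, B') (C, c, C') \<and>
      (\<forall>x\<in>carrier C. t (f x) = x) \<and> (\<forall>x\<in>carrier C'. t' (f' x) = x))"
    and extend: "\<And>(M :: ('r, ('r \<times> 'r \<times> 'r) list) module) m (N :: ('r, ('r \<times> 'r \<times> 'r) list) module) k k'.
      \<lbrakk>mor_object L (M, m, N); (k, k') \<in> mor_hom L (C, c, C') (M, m, N)\<rbrakk> \<Longrightarrow>
      (\<exists>t t'. (t, t') \<in> mor_hom L (B, b, B') (M, m, N) \<and>
        (\<forall>x\<in>carrier C. t (f x) = k x) \<and> (\<forall>x\<in>carrier C'. t' (f' x) = k' x)) \<or>
      (\<exists>t t'. (t, t') \<in> mor_hom L (M, m, N) (C, c, C') \<and>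
        (\<forall>x\<in>carrier C. t (k x) = x) \<and> (\<forall>x\<in>carrier C'. t' (k' x) = x))"
  shows "left_almost_split (T2 L) (tri_module (C, c, C')) (tri_map (f, f')) (tri_module (B, b, B'))"
  unfolding left_almost_split_def
proof (intro conjI allI impI)
  have lmC: "left_module L C" "left_module L C'" "c \<in> mod_hom L C C'"
    and lmB: "left_module L B" "left_module L B'" "b \<in> mod_hom L B B'"
    using C B by (simp_all add: fg_left_module)
  have \<sigma>: "tri_map (f, f') \<in> mod_hom (T2 L) (tri_module (C, c, C')) (tri_module (B, b, B'))"
    by (rule tri_map_mod_hom[OF C B f])
  then show "tri_map (f, f') \<in> mod_hom (T2 L) (tri_module (C, c, C')) (tri_module (B, b, B'))" .
  show "\<not> split_mono (T2 L) (tri_module (C, c, C')) (tri_map (f, f')) (tri_module (B, b, B'))"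
  proof
    assume "split_mono (T2 L) (tri_module (C, c, C')) (tri_map (f, f')) (tri_module (B, b, B'))"
    then obtain \<tau> where \<tau>: "\<tau> \<in> mod_hom (T2 L) (tri_module (B, b, B')) (tri_module (C, c, C'))"
      "\<And>x. x \<in> carrier (tri_module (C, c, C')) \<Longrightarrow> \<tau> (tri_map (f, f') x) = x"
      by (auto simp only: split_mono_def)
    obtain t t' where t: "(t, t') \<in> mor_hom L (B, b, B') (C, c, C')"
      "\<And>x. x \<in> carrier (tri_module (B, b, B')) \<Longrightarrow> \<tau> x = tri_map (t, t') x"
      using tri_module_hom_cases[OF lmB lmC \<tau>(1)] by blast
    have eq: "(t' (f' x'), t (f x)) = (x', x)" if "x \<in> carrier C" "x' \<in> carrier C'" for x x'
      using \<tau>(2)[of "(x', x)"] t(2)[OF mod_homD(1)[OF \<sigma>], of "(x', x)"] that by simp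
    interpret C: left_module L C by (rule lmC)
    interpret C': left_module L C' by (rule lmC)
    have "t (f x) = x" if "x \<in> carrier C" for x
      using eq[OF that C'.M.zero_closed] by simp
    moreover have "t' (f' x) = x" if "x \<in> carrier C'" for x
      using eq[OF C.M.zero_closed that] by simp
    ultimately show False using t(1) not_split by blast
  qed
  fix V :: "('r \<times> 'r \<times> 'r) test_module" and k
  assume V': "fg_module (T2 L) V \<and> k \<in> mod_hom (T2 L) (tri_module (C, c, C')) V \<and>
    \<not> split_mono (T2 L) (tri_module (C, c, C')) k V"
  then have V: "fg_module (T2 L) V" and k: "k \<in> mod_hom (T2 L) (tri_module (C, c, C')) V"
    by simp_all
  obtain M N :: "('r, ('r \<times> 'r \<times> 'r) list) module" and m \<phi> where ob: "mor_object L (M, m, N)"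
    and \<phi>: "\<phi> \<in> mod_hom (T2 L) V (tri_module (M, m, N))"
    "bij_betw \<phi> (carrier V) (carrier (tri_module (M, m, N)))"
    by (rule tri_module_decomposition[OF L V])
  have lmM: "left_module L M" "left_module L N" "m \<in> mod_hom L M N"
    using ob by (simp_all add: fg_left_module)
  obtain \<psi> where \<psi>: "\<psi> \<in> mod_hom (T2 L) (tri_module (M, m, N)) V"
    "\<And>x. x \<in> carrier V \<Longrightarrow> \<psi> (\<phi> x) = x"
    using mod_hom_inverse[OF \<phi> fg_left_module[OF V] tri_module_left_module[OF lmM]] by blast
  obtain k1 k2 where k12: "(k1, k2) \<in> mor_hom L (C, c, C') (M, m, N)"
    "\<And>x. x \<in> carrier (tri_module (C, c, C')) \<Longrightarrow> \<phi> (k x) = tri_map (k1, k2) x"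
    using tri_module_hom_cases[OF lmC lmM mod_hom_comp[OF k \<phi>(1)]] by blast
  show "\<exists>t\<in>mod_hom (T2 L) (tri_module (B, b, B')) V.
      \<forall>x\<in>carrier (tri_module (C, c, C')). t (tri_map (f, f') x) = k x"
    using extend[OF ob k12(1)]
  proof (elim disjE exE conjE)
    fix t t' assume t: "(t, t') \<in> mor_hom L (B, b, B') (M, m, N)"
      "\<forall>x\<in>carrier C. t (f x) = k1 x" "\<forall>x\<in>carrier C'. t' (f' x) = k2 x"
    show ?thesis
    proof (intro bexI ballI)
      show "(\<lambda>x. \<psi> (tri_map (t, t') x)) \<in> mod_hom (T2 L) (tri_module (B, b, B')) V"
        by (rule mod_hom_comp[OF tri_map_mod_hom[OF B ob t(1)] \<psi>(1)])
      fix x assume x: "x \<in> carrier (tri_module (C, c, C'))"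
      obtain y' y where y: "x = (y', y)" "y' \<in> carrier C'" "y \<in> carrier C"
        using x by (cases x) simp
      \<comment> \<open>The equation is obtained after applying \<open>\<phi>\<close>, where maps
        are pairs, and then carried back to \<open>V\<close> by \<open>\<psi>\<close>.\<close>
      have "tri_map (t, t') (tri_map (f, f') x) = \<phi> (k x)"
        using k12(2)[OF x] t(2,3) y by simp
      then show "\<psi> (tri_map (t, t') (tri_map (f, f') x)) = k x"
        by (simp only: \<psi>(2)[OF mod_homD(1)[OF k x]])
    qed
  next
    fix t t' assume t: "(t, t') \<in> mor_hom L (M, m, N) (C, c, C')"
      "\<forall>x\<in>carrier C. t (k1 x) = x" "\<forall>x\<in>carrier C'. t' (k2 x) = x"
    have \<tau>: "tri_map (t, t') \<in> mod_hom (T2 L) (tri_module (M, m, N)) (tri_module (C, c, C'))"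
      by (rule tri_map_mod_hom[OF ob C t(1)])
    have split: "tri_map (t, t') (\<phi> (k x)) = x" if x: "x \<in> carrier (tri_module (C, c, C'))" for x
    proof -
      obtain y' y where y: "x = (y', y)" "y' \<in> carrier C'" "y \<in> carrier C"
        using x by (cases x) simp
      show ?thesis
        using k12(2)[OF x] t(2,3) y by simp
    qed
    have "split_mono (T2 L) (tri_module (C, c, C')) k V"
      unfolding split_mono_def
      by (intro conjI k bexI[OF _ mod_hom_comp[OF \<phi>(1) \<tau>]] ballI split)
    then show ?thesis using V' by blast
  qed
qed

theorem proposition3p5:
  fixes R :: "'k ring" and L :: "('k, 'r) module"
    and A :: "('r, 'a) module" and B :: "('r, 'b) module" and C :: "('r, 'c) module"
    and P :: "('r, 'p) module" and I :: "('r, 'i) module"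
    and Z :: "('r, 'z) module" and Y :: "('r, 'y) module"
    and f :: "'c \<Rightarrow> 'b" and g :: "'b \<Rightarrow> 'a" and p :: "'p \<Rightarrow> 'a" and e :: "'c \<Rightarrow> 'i"
    and s :: "'c \<Rightarrow> 'z" and l :: "'z \<Rightarrow> 'p" and h :: "'z \<Rightarrow> 'b"
    and u :: "'i \<Rightarrow> 'y" and v :: "'y \<Rightarrow> 'a" and d :: "'b \<Rightarrow> 'y"
  assumes "artin_algebra R L"
    and "fg_module L A" and "indecomposable L A" and "\<not> projective L A"
    and "almost_split_seq L C f B g A"
    and "projective_cover L P p A"
    and "injective_envelope L C e I"
    and "pullback_seq L C f B g A P p s Z l h"
    and "pushout_seq L C f B g A I e u Y v d"
  shows "mor_almost_split_seq L (C, e, I) (s, u) (Z, d \<circ> h, Y) (l, v) (P, p, A)"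
proof -
  interpret almost_split_diagram L A B C P I Z Y f g p e s l h u v d
    by unfold_locales (rule assms)+
  have L: "ring L"
    using assms(1) by (simp add: artin_algebra_def)
  have ob: "mor_object L (C, e, I)" "mor_object L (Z, d \<circ> h, Y)" "mor_object L (P, p, A)"
    using mod_hom_comp[OF pullback_hom pushout_hom] by (simp_all add: fg_modules envelope_hom(1) cover_hom(1) comp_def)
  have su: "(s, u) \<in> mor_hom L (C, e, I) (Z, d \<circ> h, Y)"
    using exact_Z(4) exact_Y(4) by (simp add: hs df)
  have lv: "(l, v) \<in> mor_hom L (Z, d \<circ> h, Y) (P, p, A)"
    using exact_Z(5) exact_Y(5) by (simp add: vd gh mod_homD(1)[OF pullback_hom])
  \<comment> \<open>\<open>left_extend\<close> and \<open>right_lift\<close> hold for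
    \<open>M\<close> and \<open>N\<close> of any carrier type; here they are specialized to the
    lists of triples in which the test modules over \<open>T2 L\<close> live.\<close>
  have "left_almost_split (T2 L) (tri_module (C, e, I)) (tri_map (s, u)) (tri_module (Z, d \<circ> h, Y))"
    by (rule tri_left_almost_split[OF L ob(1,2) su _ left_extend]) (use not_split_mono in blast)+
  moreover have "right_almost_split (T2 L) (tri_module (Z, d \<circ> h, Y)) (tri_map (l, v)) (tri_module (P, p, A))"
    by (rule tri_right_almost_split[OF L ob(2,3) lv _ right_lift]) (use not_split_epi in blast)+
  ultimately show ?thesis
    using ob su lv tri_short_exact[OF ob su lv exact(2,3)]
    unfolding mor_almost_split_seq_def almost_split_seq_def by blast
qed

end
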